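(* Let $G$ be an abelian group, $\mu$ a measure on $G$, and let $f,k\colon G\to\mathbb{C}$ be nonzero functions such that the integral $$\int\bigl[f(x+y-t)+f(x-y+t)\bigr]\,d\mu(t)$$ exists for each $x,y\in G$, and such that $$\int\bigl[f(x+y-t)+f(x-y+t)\bigr]\,d\mu(t)=f(x)k(y)\qquad\text{for all }x,y\in G.\tag{$*$}$$ Then one of the following holds: (i) $f(x)=\gamma m(x)+\delta m(-x)$ and $k(x)=\widehat{\mu}(m)m(x)+\widehat{\mu}(\check{m})m(-x)$ for each $x\in G$, where $m$ is an exponential and $\gamma,\delta$ are complex numbers; (ii) $f(x)=\left[\frac{1}{2\widehat{\mu}(m_0)}a(x)+\beta\right]m_0(x)$ and $k(x)=2\widehat{\mu}(m_0)m_0(x)$ for each $x\in G$, where $m_0$ is an even exponential with $\widehat{\mu}(m_0)\neq 0$, $a$ is an additive function, and $\beta$ is a complex number. Conversely, the functions $f,k$ given in (i) and (ii) are solutions of $( * )$, whenever the given conditions are satisfied. If $G$ is a topological group and $f$ or $k$ is continuous, then $a$, $m$ and $m_0$ (those that occur) are continuous, too. If $G$ is locally compact and $f$ or $k$ is Haar measurable, then $f,k,a,m,m_0$ (those that occur) are continuous. If $f$ or $k$ is essentially bounded and Haar measurable, then $a=0$, the functions $f,k,m,m_0$ (those that occur) are continuous, and moreover $m,m_0$ are characters of $G$.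
   Context: For $f\colon G\to\mathbb{C}$ put $\check{f}(x)=f(-x)$; $f$ is even if $\check f=f$. An exponential on $G$ is a nonzero function $m\colon G\to\mathbb{C}$ with $m(x+y)=m(x)m(y)$ for all $x,y\in G$. A function $a\colon G\to\mathbb{C}$ is additive if $a(x+y)=a(x)+a(y)$ for all $x,y\in G$. Here $\mu$ is a complex measure on $G$, and $\mu$ and the functions are assumed to be such that all integrals involved exist (for instance, $G$ a topological abelian group, $\mu$ a compactly supported Radon measure and $f,k$ continuous; or $G$ discrete and $\mu$ finitely supported). For an exponential $m$ integrable with respect to $\mu$, $\widehat{\mu}(m)=\int\check{m}\,d\mu=\int m(-t)\,d\mu(t)$. In the last regularity statement, essential boundedness and measurability are with respect to Haar measure on the locally compact abelian group $G$, and a character is a continuous homomorphism from $G$ into the multiplicative group of complex numbers of modulus $1$.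
   Formalization: In case (ii), if only k is assumed continuous, Haar measurable or essentially bounded, nothing is claimed about a or f (only k, m_0): with μ=δ_0, m_0=1, k=2, f=a/2+1, any additive a gives a solution, so the literal claim about a and f is false. *)

theory Defs
  imports "HOL-Analysis.Analysis"
begin

section \<open>Complex measures and their integrals\<close>

text \<open>A complex measure is a countably additive complex-valued function on a sigma-algebra of
  subsets of the whole type. Convergence of the series already forces the value 0 on the empty
  set.\<close>

definition complex_measure :: "'a set set \<Rightarrow> ('a set \<Rightarrow> complex) \<Rightarrow> bool" where
  "complex_measure A \<mu> \<longleftrightarrow> sigma_algebra UNIV A \<and>
     (\<forall>E::nat \<Rightarrow> 'a set. range E \<subseteq> A \<longrightarrow> disjoint_family E \<longrightarrow>
        (\<lambda>n. \<mu> (E n)) sums \<mu> (\<Union>n. E n))"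

text \<open>The positive part \<open>E \<mapsto> sup {\<nu> B | B \<subseteq> E}\<close> of the Jordan decomposition of a real
  countably additive \<open>\<nu>\<close>. Truncating negative values by \<^const>\<open>ennreal\<close> is harmless because
  \<open>B = {}\<close> is admissible.\<close>

definition pos_variation :: "'a set set \<Rightarrow> ('a set \<Rightarrow> real) \<Rightarrow> 'a measure" where
  "pos_variation A \<nu> = measure_of UNIV A (\<lambda>E. SUP B\<in>{B\<in>A. B \<subseteq> E}. ennreal (\<nu> B))"

text \<open>\<^const>\<open>measure_of\<close> returns the zero measure on set functions that are not countably
  additive; this case does not arise here.\<close>

lemma emeasure_pos_variation:
  fixes \<nu> :: "'a set \<Rightarrow> real"
  assumes A: "sigma_algebra UNIV A"
    and \<nu>: "\<And>E::nat \<Rightarrow> 'a set. range E \<subseteq> A \<Longrightarrow> disjoint_family E \<Longrightarrow>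
              (\<lambda>n. \<nu> (E n)) sums \<nu> (\<Union>n. E n)"
    and E: "E \<in> A"
  shows "emeasure (pos_variation A \<nu>) E = (SUP B\<in>{B\<in>A. B \<subseteq> E}. ennreal (\<nu> B))"
proof -
  interpret sigma_algebra UNIV A by (rule A)
  define v where "v = (\<lambda>E. SUP B\<in>{B\<in>A. B \<subseteq> E}. ennreal (\<nu> B))"
  have \<nu>0: "\<nu> {} = 0"
  proof -
    have "(\<lambda>n::nat. \<nu> {}) sums \<nu> {}"
      using \<nu>[of "\<lambda>_. {}"] by (simp add: disjoint_family_on_def)
    then show ?thesis
      using summable_const_iff sums_summable by blast
  qed
  have \<nu>2: "\<nu> (B \<union> C) = \<nu> B + \<nu> C" if "B \<in> A" "C \<in> A" "B \<inter> C = {}" for B C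
  proof -
    have "(\<lambda>n. \<nu> (binaryset B C n)) sums \<nu> (\<Union>n. binaryset B C n)"
    proof (rule \<nu>)
      show "range (binaryset B C) \<subseteq> A"
        unfolding range_binaryset_eq using that by simp
      show "disjoint_family (binaryset B C)"
        unfolding disjoint_family_on_def binaryset_def using that by auto
    qed
    moreover have "(\<lambda>n. \<nu> (binaryset B C n)) sums (\<nu> B + \<nu> C)"
      by (rule binaryset_sums) (rule \<nu>0)
    ultimately show ?thesis
      by (metis UN_binaryset_eq sums_unique2)
  qed
  have v_ge: "ennreal (\<nu> B) \<le> v F" if "B \<in> A" "B \<subseteq> F" for B F
    unfolding v_def using that by (intro SUP_upper) auto
  have v_mono: "v F \<le> v F'" if "F \<subseteq> F'" for F F'
    unfolding v_def using that by (intro SUP_subset_mono) auto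
  have v0: "v {} = 0"
  proof -
    have "{B \<in> A. B \<subseteq> {}} = {{}}" by auto
    then show ?thesis by (simp add: v_def \<nu>0)
  qed
  have v_super: "v F + v G \<le> v (F \<union> G)" if disj: "F \<inter> G = {}" for F G
  proof -
    have *: "ennreal (\<nu> B) + ennreal (\<nu> C) \<le> v (F \<union> G)"
      if "B \<in> A" "B \<subseteq> F" "C \<in> A" "C \<subseteq> G" for B C
    proof (cases "0 \<le> \<nu> B \<and> 0 \<le> \<nu> C")
      case True
      have "B \<inter> C = {}" using that disj by blast
      then have "ennreal (\<nu> B) + ennreal (\<nu> C) = ennreal (\<nu> (B \<union> C))"
        using True that by (simp add: \<nu>2)
      also have "\<dots> \<le> v (F \<union> G)" using that by (intro v_ge) auto
      finally show ?thesis .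
    next
      case False
      then have "ennreal (\<nu> B) = 0 \<or> ennreal (\<nu> C) = 0" by (auto simp: ennreal_neg)
      then show ?thesis
        using v_ge[of B "F \<union> G"] v_ge[of C "F \<union> G"] that by (auto simp: le_supI1 le_supI2)
    qed
    let ?I = "\<lambda>E. {B \<in> A. B \<subseteq> E}"
    have ne: "?I E \<noteq> {}" for E by blast
    have 1: "v F + ennreal (\<nu> C) \<le> v (F \<union> G)" if C: "C \<in> A" "C \<subseteq> G" for C
    proof -
      have "v F + ennreal (\<nu> C) = (SUP B\<in>?I F. ennreal (\<nu> B) + ennreal (\<nu> C))"
        unfolding v_def by (rule ennreal_SUP_add_left[OF ne, symmetric])
      also have "\<dots> \<le> v (F \<union> G)"
        by (rule SUP_least) (use * C in blast)
      finally show ?thesis .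
    qed
    have "v F + v G = (SUP C\<in>?I G. v F + ennreal (\<nu> C))"
      unfolding v_def[THEN fun_cong, of G] by (rule ennreal_SUP_add_right[OF ne])
    also have "\<dots> \<le> v (F \<union> G)"
      by (rule SUP_least) (use 1 in blast)
    finally show ?thesis .
  qed
  have "countably_additive A v"
    unfolding countably_additive_def
  proof (intro allI impI)
    fix D :: "nat \<Rightarrow> 'a set"
    assume D: "range D \<subseteq> A" "disjoint_family D" "(\<Union>i. D i) \<in> A"
    show "(\<Sum>i. v (D i)) = v (\<Union>i. D i)"
    proof (rule antisym)
      have fin: "(\<Sum>i<n. v (D i)) \<le> v (\<Union>i<n. D i)" for n
      proof (induction n)
        case 0
        show ?case by (simp add: v0)
      next
        case (Suc n)
        have "(\<Union>i<n. D i) \<inter> D n = {}"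
        proof -
          have "D i \<inter> D n = {}" if "i < n" for i
            using that by (intro disjoint_family_onD[OF D(2)]) simp_all
          then show ?thesis by blast
        qed
        then have "v (\<Union>i<n. D i) + v (D n) \<le> v ((\<Union>i<n. D i) \<union> D n)" by (rule v_super)
        also have "(\<Union>i<n. D i) \<union> D n = (\<Union>i<Suc n. D i)" by (auto simp: less_Suc_eq)
        finally have "v (\<Union>i<n. D i) + v (D n) \<le> v (\<Union>i<Suc n. D i)" .
        with add_right_mono[OF Suc, of "v (D n)"] show ?case
          unfolding sum.lessThan_Suc by (rule order_trans)
      qed
      show "(\<Sum>i. v (D i)) \<le> v (\<Union>i. D i)"
      proof (rule suminf_le_const)
        show "(\<Sum>i<n. v (D i)) \<le> v (\<Union>i. D i)" for n
          by (rule order_trans[OF fin v_mono]) blast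
      qed simp
    next
      show "v (\<Union>i. D i) \<le> (\<Sum>i. v (D i))"
      proof (subst v_def, rule SUP_least)
        fix B assume B: "B \<in> {B \<in> A. B \<subseteq> (\<Union>i. D i)}"
        have "(\<lambda>n. \<nu> (B \<inter> D n)) sums \<nu> (\<Union>n. B \<inter> D n)"
        proof (rule \<nu>)
          show "range (\<lambda>n. B \<inter> D n) \<subseteq> A" using B D(1) by auto
          show "disjoint_family (\<lambda>n. B \<inter> D n)"
            unfolding disjoint_family_on_def using disjoint_family_onD[OF D(2)] by blast
        qed
        moreover have "(\<Union>n. B \<inter> D n) = B" using B by auto
        ultimately have "(\<lambda>n. \<Sum>i<n. \<nu> (B \<inter> D i)) \<longlonglongrightarrow> \<nu> B" by (simp add: sums_def)
        then have lim: "(\<lambda>n. ennreal (\<Sum>i<n. \<nu> (B \<inter> D i))) \<longlonglongrightarrow> ennreal (\<nu> B)"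
          by (rule tendsto_ennrealI)
        have "ennreal (\<Sum>i<n. \<nu> (B \<inter> D i)) \<le> (\<Sum>i. v (D i))" for n
        proof -
          have "ennreal (\<Sum>i<n. \<nu> (B \<inter> D i)) \<le> ennreal (\<Sum>i<n. max 0 (\<nu> (B \<inter> D i)))"
            by (intro ennreal_leI sum_mono) auto
          also have "\<dots> = (\<Sum>i<n. ennreal (\<nu> (B \<inter> D i)))"
            by (subst sum_ennreal[symmetric]) (simp_all only: max.cobounded1 ennreal_max_0)
          also have "\<dots> \<le> (\<Sum>i<n. v (D i))"
            using B D by (intro sum_mono v_ge) auto
          also have "\<dots> \<le> (\<Sum>i. v (D i))" by (rule sum_le_suminf) auto
          finally show ?thesis .
        qed
        then show "ennreal (\<nu> B) \<le> (\<Sum>i. v (D i))"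
          by (intro LIMSEQ_le_const2[OF lim]) auto
      qed
    qed
  qed
  moreover have "positive A v" by (simp add: positive_def v0)
  ultimately show ?thesis
    using emeasure_measure_of_sigma[OF sigma_algebra_axioms, of v E] E
    by (simp add: pos_variation_def v_def)
qed

text \<open>A function is integrable with respect to a complex measure iff it is integrable with
  respect to its total variation, i.e. with respect to all four parts of its Jordan
  decomposition.\<close>

definition cm_integrable ::
  "'a set set \<Rightarrow> ('a set \<Rightarrow> complex) \<Rightarrow> ('a \<Rightarrow> complex) \<Rightarrow> bool" where
  "cm_integrable A \<mu> g \<longleftrightarrow>
     integrable (pos_variation A (\<lambda>E. Re (\<mu> E))) g \<and>
     integrable (pos_variation A (\<lambda>E. - Re (\<mu> E))) g \<and>
     integrable (pos_variation A (\<lambda>E. Im (\<mu> E))) g \<and>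
     integrable (pos_variation A (\<lambda>E. - Im (\<mu> E))) g"

definition cm_integral ::
  "'a set set \<Rightarrow> ('a set \<Rightarrow> complex) \<Rightarrow> ('a \<Rightarrow> complex) \<Rightarrow> complex" where
  "cm_integral A \<mu> g =
     ((LINT t|pos_variation A (\<lambda>E. Re (\<mu> E)). g t) -
      (LINT t|pos_variation A (\<lambda>E. - Re (\<mu> E)). g t)) +
     \<i> * ((LINT t|pos_variation A (\<lambda>E. Im (\<mu> E)). g t) -
          (LINT t|pos_variation A (\<lambda>E. - Im (\<mu> E)). g t))"

section \<open>The functional equation and its two families of solutions\<close>

definition check :: "('a::ab_group_add \<Rightarrow> complex) \<Rightarrow> 'a \<Rightarrow> complex" where
  "check f = (\<lambda>x. f (- x))"

definition exponential :: "('a::ab_group_add \<Rightarrow> complex) \<Rightarrow> bool" where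
  "exponential m \<longleftrightarrow> m \<noteq> (\<lambda>_. 0) \<and> (\<forall>x y. m (x + y) = m x * m y)"

definition cm_hat ::
  "'a::ab_group_add set set \<Rightarrow> ('a set \<Rightarrow> complex) \<Rightarrow> ('a \<Rightarrow> complex) \<Rightarrow> complex" where
  "cm_hat A \<mu> m = cm_integral A \<mu> (check m)"

definition solves ::
  "'a::ab_group_add set set \<Rightarrow> ('a set \<Rightarrow> complex) \<Rightarrow> ('a \<Rightarrow> complex) \<Rightarrow> ('a \<Rightarrow> complex) \<Rightarrow> bool"
  where
  "solves A \<mu> f k \<longleftrightarrow> (\<forall>x y.
     cm_integrable A \<mu> (\<lambda>t. f (x + y - t) + f (x - y + t)) \<and>
     cm_integral A \<mu> (\<lambda>t. f (x + y - t) + f (x - y + t)) = f x * k y)"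

text \<open>Integrability of the exponentials is stated explicitly, since otherwise the transform
  \<^const>\<open>cm_hat\<close> would be a junk value. In the second form one condition suffices, as
  \<open>m0\<close> is even.\<close>

definition form_i ::
  "'a::ab_group_add set set \<Rightarrow> ('a set \<Rightarrow> complex) \<Rightarrow> ('a \<Rightarrow> complex) \<Rightarrow> ('a \<Rightarrow> complex) \<Rightarrow>
   ('a \<Rightarrow> complex) \<Rightarrow> complex \<Rightarrow> complex \<Rightarrow> bool" where
  "form_i A \<mu> f k m \<gamma> \<delta> \<longleftrightarrow>
     exponential m \<and> cm_integrable A \<mu> m \<and> cm_integrable A \<mu> (check m) \<and>
     (\<forall>x. f x = \<gamma> * m x + \<delta> * m (- x)) \<and>
     (\<forall>x. k x = cm_hat A \<mu> m * m x + cm_hat A \<mu> (check m) * m (- x))"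

definition form_ii ::
  "'a::ab_group_add set set \<Rightarrow> ('a set \<Rightarrow> complex) \<Rightarrow> ('a \<Rightarrow> complex) \<Rightarrow> ('a \<Rightarrow> complex) \<Rightarrow>
   ('a \<Rightarrow> complex) \<Rightarrow> ('a \<Rightarrow> complex) \<Rightarrow> complex \<Rightarrow> bool" where
  "form_ii A \<mu> f k m0 a \<beta> \<longleftrightarrow>
     exponential m0 \<and> check m0 = m0 \<and> cm_integrable A \<mu> m0 \<and> cm_hat A \<mu> m0 \<noteq> 0 \<and>
     Modules.additive a \<and>
     (\<forall>x. f x = (1 / (2 * cm_hat A \<mu> m0) * a x + \<beta>) * m0 x) \<and>
     (\<forall>x. k x = 2 * cm_hat A \<mu> m0 * m0 x)"

section \<open>Topological groups and Haar measure\<close>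

definition topological_group :: "'a::ab_group_add topology \<Rightarrow> bool" where
  "topological_group T \<longleftrightarrow> topspace T = UNIV \<and>
     continuous_map (prod_topology T T) T (\<lambda>(x, y). x + y) \<and>
     continuous_map T T uminus"

text \<open>As usual, locally compact groups are Hausdorff.\<close>

definition lca_group :: "'a::ab_group_add topology \<Rightarrow> bool" where
  "lca_group T \<longleftrightarrow> topological_group T \<and> locally_compact_space T \<and> Hausdorff_space T"

definition haar_measure :: "'a::ab_group_add topology \<Rightarrow> 'a measure \<Rightarrow> bool" where
  "haar_measure T H \<longleftrightarrow>
     space H = UNIV \<and> sets H = sigma_sets UNIV {U. openin T U} \<and>
     emeasure H UNIV \<noteq> 0 \<and>
     (\<forall>K. compactin T K \<longrightarrow> emeasure H K < \<infinity>) \<and>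
     (\<forall>E\<in>sets H. emeasure H E = (INF U\<in>{U. openin T U \<and> E \<subseteq> U}. emeasure H U)) \<and>
     (\<forall>U. openin T U \<longrightarrow> emeasure H U = (SUP K\<in>{K. compactin T K \<and> K \<subseteq> U}. emeasure H K)) \<and>
     (\<forall>x. \<forall>E\<in>sets H. emeasure H ((\<lambda>y. x + y) ` E) = emeasure H E)"

text \<open>Measurability with respect to the Caratheodory sigma-algebra of the outer Haar measure.
  It contains the completion of the Borel sets, and coincides with it for sigma-compact groups.\<close>

definition haar_measurable :: "'a measure \<Rightarrow> ('a \<Rightarrow> complex) \<Rightarrow> bool" where
  "haar_measurable H f \<longleftrightarrow>
     f \<in> borel_measurable (sigma UNIV (lambda_system UNIV (Pow UNIV) (outer_measure_of H)))"

definition ess_bounded :: "'a measure \<Rightarrow> ('a \<Rightarrow> complex) \<Rightarrow> bool" where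
  "ess_bounded H f \<longleftrightarrow> (\<exists>C. AE x in H. norm (f x) \<le> C)"

abbreviation continuous_in :: "'a topology \<Rightarrow> ('a \<Rightarrow> complex) \<Rightarrow> bool" where
  "continuous_in T f \<equiv> continuous_map T euclidean f"

definition character :: "'a::ab_group_add topology \<Rightarrow> ('a \<Rightarrow> complex) \<Rightarrow> bool" where
  "character T m \<longleftrightarrow> continuous_in T m \<and> (\<forall>x. norm (m x) = 1) \<and> (\<forall>x y. m (x + y) = m x * m y)"

end

theory Submission
  imports Defs
begin

text \<open>Put \<open>F x w = f (x + w) + f (x - w)\<close>. The integral equation says that the integral of
  \<open>t \<mapsto> F x (y - t)\<close> is \<open>f x * k y\<close>. The identity
  \<open>F (x + z) w + F (x - z) w = F x (w + z) + F x (w - z)\<close> and the linearity of the integral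
  turn it into
  \<open>(f (x + z) + f (x - z)) * k y = f x * (k (y + z) + k (y - z))\<close>. So \<open>f\<close> solves Wilson's
  equation \<open>f (x + z) + f (x - z) = 2 * f x * g z\<close> (\<open>solves_imp_wilson\<close>), where \<open>g\<close> is
  necessarily a solution of d'Alembert's equation. Wilson's equation on an abelian group is solved
  by splitting \<open>f\<close> into its even part, a multiple of \<open>g\<close>, and its odd part, which obeys the
  addition law of the sine (\<open>wilson_solution\<close>): either \<open>g\<close> has a nonzero sine, and then
  \<open>g\<close> and \<open>f\<close> are combinations of \<open>m\<close> and its reflection for an exponential \<open>m\<close>, or
  \<open>g\<close> is an even exponential and \<open>f\<close> is that exponential times an additive function plus a
  constant. Inserting \<open>F x w = 2 * f x * g w\<close> into the equation yields \<open>k\<close>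
  (\<open>solves_imp_form\<close>).

  For the regularity statements, the exponential, or its reflection, is recovered from \<open>f\<close> or \<open>k\<close>
  as a linear combination of two translates (\<open>exponential_pair_component\<close>,
  \<open>exponential_affine_component\<close>), so it inherits every property that is stable under such
  combinations: continuity, Haar measurability and boundedness. A Haar measurable exponential or
  additive function is continuous by Steinhaus's theorem: it is nearly constant on some set of
  positive measure, hence close to its value at zero on the differences of that set, which contain a
  neighbourhood of zero (\<open>steinhaus\<close>, \<open>haar_measurable_near_diagonal\<close>). Finally, a continuous
  essentially bounded function is bounded, a bounded exponential has modulus 1, and a bounded
  additive function vanishes.\<close>

section \<open>Linearity of the integral against a complex measure\<close>

lemma cm_integrable_mult_right:
  "cm_integrable A \<mu> g \<Longrightarrow> cm_integrable A \<mu> (\<lambda>t. c * g t)"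
  by (simp add: cm_integrable_def)

lemma cm_integrable_add:
  "cm_integrable A \<mu> g \<Longrightarrow> cm_integrable A \<mu> h \<Longrightarrow> cm_integrable A \<mu> (\<lambda>t. g t + h t)"
  by (simp add: cm_integrable_def)

lemma cm_integral_mult_right:
  "cm_integrable A \<mu> g \<Longrightarrow> cm_integral A \<mu> (\<lambda>t. c * g t) = c * cm_integral A \<mu> g"
  by (simp add: cm_integrable_def cm_integral_def algebra_simps)

lemma cm_integral_add:
  "cm_integrable A \<mu> g \<Longrightarrow> cm_integrable A \<mu> h \<Longrightarrow>
     cm_integral A \<mu> (\<lambda>t. g t + h t) = cm_integral A \<mu> g + cm_integral A \<mu> h"
  by (simp add: cm_integrable_def cm_integral_def algebra_simps)

section \<open>Exponentials\<close>

lemma exponential_add: "exponential m \<Longrightarrow> m (x + y) = m x * m y"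
  by (simp add: exponential_def)

lemma exponential_nonzero:
  assumes "exponential m"
  shows "m x \<noteq> 0"
proof
  assume "m x = 0"
  then have "m y = 0" for y
    using exponential_add[OF assms, of x "y - x"] by simp
  then show False
    using assms by (auto simp: exponential_def)
qed

lemma exponential_zero: "exponential m \<Longrightarrow> m 0 = 1"
  using exponential_add[of m 0 0] exponential_nonzero[of m 0] by simp

lemma exponential_minus: "exponential m \<Longrightarrow> m x * m (- x) = 1"
  using exponential_add[of m x "- x"] exponential_zero[of m] by simp

lemma exponential_diff: "exponential m \<Longrightarrow> m (x - y) = m x * m (- y)"
  using exponential_add[of m x "- y"] by simp

lemma exponential_check: "exponential m \<Longrightarrow> exponential (check m)"
  using exponential_nonzero[of m] exponential_add[of m "- _" "- _"]
  unfolding check_def exponential_def[of "\<lambda>x. m (- x)"] by (simp add: fun_eq_iff)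

section \<open>The equations of Wilson and d'Alembert\<close>

text \<open>Wilson's functional equation for \<open>f\<close>; d'Alembert's equation is \<open>wilson g g\<close>.\<close>

definition wilson :: "('a::ab_group_add \<Rightarrow> complex) \<Rightarrow> ('a \<Rightarrow> complex) \<Rightarrow> bool" where
  "wilson g f \<longleftrightarrow> (\<forall>x y. f (x + y) + f (x - y) = 2 * f x * g y)"

lemma wilsonD: "wilson g f \<Longrightarrow> f (x + y) + f (x - y) = 2 * f x * g y"
  by (simp add: wilson_def)

text \<open>The four values \<open>f (u \<plusminus> x \<plusminus> y)\<close>, with \<open>f u \<noteq> 0\<close>, can be paired in two ways: around
  \<open>u\<close>, which produces \<open>g (x + y) + g (x - y)\<close>, or around \<open>u + x\<close> and \<open>u - x\<close>, which
  produces \<open>2 * g x * g y\<close>.\<close>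

lemma wilson_imp_dalembert:
  assumes "wilson g f" "f \<noteq> (\<lambda>_. 0)"
  shows "wilson g g" "g 0 = 1" "g (- x) = g x"
proof -
  note W = wilsonD[OF assms(1)]
  obtain u where u: "f u \<noteq> 0" using assms(2) by auto
  show "g 0 = 1" using W[of u 0] u by simp
  have "2 * f u * g (- x) = 2 * f u * g x"
    unfolding W[symmetric] by (simp add: add.commute)
  then show "g (- x) = g x" using u by (subst (asm) mult_cancel_left) simp
  show "wilson g g"
    unfolding wilson_def
  proof (intro allI)
    fix x y
    have "2 * f u * (g (x + y) + g (x - y)) =
        (f (u + (x + y)) + f (u - (x + y))) + (f (u + (x - y)) + f (u - (x - y)))"
      unfolding W by (simp add: algebra_simps)
    also have "\<dots> = (f ((u + x) + y) + f ((u + x) - y)) + (f ((u - x) + y) + f ((u - x) - y))"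
      by (simp add: algebra_simps)
    also have "\<dots> = 2 * (f (u + x) + f (u - x)) * g y"
      unfolding W[of "u + x" y] W[of "u - x" y] by (simp add: algebra_simps)
    also have "\<dots> = 2 * f u * (2 * g x * g y)"
      by (simp add: W)
    finally have "(2 * f u) * (g (x + y) + g (x - y)) = (2 * f u) * (2 * g x * g y)" .
    then show "g (x + y) + g (x - y) = 2 * g x * g y"
      using u by (subst (asm) mult_cancel_left) simp
  qed
qed

text \<open>Add Wilson's equation to the one with \<open>x\<close> and \<open>y\<close> exchanged: by oddness the terms
  \<open>h (x - y)\<close> and \<open>h (y - x)\<close> cancel.\<close>

lemma sine_addition:
  assumes "wilson g h" and odd: "\<And>x. h (- x) = - h x"
  shows "h (x + y) = h x * g y + g x * h y"
proof -
  have "h (x + y) + h (x - y) = 2 * h x * g y" "h (y + x) + h (y - x) = 2 * h y * g x"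
    by (simp_all add: wilsonD[OF assms(1)])
  moreover have "h (y - x) = - h (x - y)" using odd[of "x - y"] by simp
  ultimately have "2 * h (x + y) = 2 * (h x * g y + g x * h y)"
    by (simp add: algebra_simps flip: mult_2)
  then show ?thesis by (subst (asm) mult_cancel_left) simp
qed

text \<open>Expanding \<open>h (x + y + w)\<close> along the two ways to bracket the sum leaves this identity. It makes
  \<open>g (x + y) - g x * g y\<close> computable from any odd \<open>h\<close> that does not vanish.\<close>

lemma sine_exchange:
  fixes g h :: "'a::ab_group_add \<Rightarrow> complex"
  assumes S: "\<And>x y. h (x + y) = h x * g y + g x * h y"
  shows "h x * (g (y + w) - g y * g w) = h w * (g (x + y) - g x * g y)"
proof -
  have "h (x + y + w) = h (x + (y + w))" by (simp add: add.assoc)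
  then show ?thesis unfolding S by (simp add: algebra_simps)
qed

text \<open>Two signs whose sum is \<open>2 * g x * g y = \<plusminus> 2\<close> are both equal to \<open>g x * g y\<close>.\<close>

lemma dalembert_values_pm1:
  assumes "wilson g g" and pm: "\<And>x. (g x)\<^sup>2 = 1"
  shows "g (x + y) = g x * g y"
proof -
  have pm: "g x = 1 \<or> g x = -1" for x using pm[of x] by (simp add: power2_eq_1_iff)
  show ?thesis
    using wilsonD[OF assms(1), of x y] pm[of "x + y"] pm[of "x - y"] pm[of x] pm[of y] by auto
qed

lemma wilson_odd_part:
  assumes "wilson g f" "wilson g g" and even: "\<And>x. g (- x) = g x"
  defines "h \<equiv> \<lambda>x. f x - f 0 * g x"
  shows "wilson g h" "h (- x) = - h x"
proof -
  show "wilson g h"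
    unfolding wilson_def
  proof (intro allI)
    fix x y
    have "h (x + y) + h (x - y) = (f (x + y) + f (x - y)) - f 0 * (g (x + y) + g (x - y))"
      by (simp add: h_def algebra_simps)
    then show "h (x + y) + h (x - y) = 2 * h x * g y"
      unfolding wilsonD[OF assms(1)] wilsonD[OF assms(2)] by (simp add: h_def algebra_simps)
  qed
  have "f x + f (- x) = 2 * f 0 * g x"
    using wilsonD[OF assms(1), of 0 x] by simp
  then have "f (- x) = 2 * f 0 * g x - f x" by (simp add: eq_diff_eq add.commute)
  then show "h (- x) = - h x" by (simp add: h_def even)
qed

text \<open>The even part of \<open>f\<close> is \<open>f 0 * g\<close>; the odd part satisfies the addition law of the sine.
  If \<open>g\<close> takes only the values \<open>\<plusminus> 1\<close>, it is an even exponential, and dividing the odd part by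
  it yields an additive function. Otherwise some difference of translates
  \<open>s x = g (x + z) - g (x - z)\<close> of \<open>g\<close> is a nonzero odd solution, to which every odd
  solution is proportional, and \<open>g + c * s\<close> is an exponential for a suitable scalar \<open>c\<close>.
  The formula for \<open>m\<close> is part of the conclusion because integrability will be known for the
  translates of \<open>g\<close> and has to be carried over to \<open>m\<close>.\<close>

lemma wilson_solution:
  assumes "wilson g f" "f \<noteq> (\<lambda>_. 0)"
  shows "(\<exists>m \<gamma> \<delta> c z. exponential m \<and> (\<forall>x. f x = \<gamma> * m x + \<delta> * m (- x)) \<and>
            (\<forall>x. 2 * g x = m x + m (- x)) \<and> (\<forall>x. m x = g x + c * (g (x + z) - g (x - z)))) \<or>
         (exponential g \<and> check g = g \<and>
            (\<exists>b. Modules.additive b \<and> (\<forall>x. f x = (b x + f 0) * g x)))"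
proof -
  note gg = wilson_imp_dalembert(1)[OF assms]
    and g0 = wilson_imp_dalembert(2)[OF assms]
    and even = wilson_imp_dalembert(3)[OF assms]
  define h where "h = (\<lambda>x. f x - f 0 * g x)"
  have h: "wilson g h" "\<And>x. h (- x) = - h x"
    unfolding h_def using wilson_odd_part[OF assms(1) gg even] by simp_all
  note hS = sine_addition[OF h]
  show ?thesis
  proof (cases "\<forall>x. (g x)\<^sup>2 = 1")
    case True
    then have mult: "g (x + y) = g x * g y" for x y
      using dalembert_values_pm1[OF gg] by blast
    have "exponential g" using mult g0 by (auto simp: exponential_def fun_eq_iff intro!: exI[of _ 0])
    moreover have "check g = g" using even by (simp add: check_def)
    moreover define b where "b = (\<lambda>x. h x * g x)"
    have "g x * g x = 1" for x using True by (simp add: power2_eq_square)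
    then have gg1: "g x * (g x * w) = w" for x w by (metis mult.assoc mult_1)
    have "Modules.additive b"
      unfolding Modules.additive_def b_def by (simp add: hS mult algebra_simps gg1)
    moreover have "f x = (b x + f 0) * g x" for x
      using gg1[of x "h x"] by (simp add: b_def h_def algebra_simps)
    ultimately show ?thesis by blast
  next
    case False
    then obtain z where z: "(g z)\<^sup>2 \<noteq> 1" by blast
    define s where "s = (\<lambda>x. g (x + z) - g (x - z))"
    have s_eq: "s x = 2 * (g (x + z) - g x * g z)" for x
      using wilsonD[OF gg, of x z] by (simp add: s_def algebra_simps)
    have ws: "wilson g s"
      unfolding wilson_def
    proof (intro allI)
      fix x y
      show "s (x + y) + s (x - y) = 2 * s x * g y"
        using wilsonD[OF gg, of "x + z" y] wilsonD[OF gg, of "x - z" y]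
        by (simp add: s_def algebra_simps)
    qed
    have os: "s (- x) = - s x" for x
      using even[of "x + z"] even[of "x - z"] by (simp add: s_def algebra_simps)
    have sz: "s z \<noteq> 0"
    proof -
      have "g (z + z) + 1 = 2 * (g z)\<^sup>2"
        using wilsonD[OF gg, of z z] g0 by (simp add: power2_eq_square)
      then have "g (z + z) = 2 * (g z)\<^sup>2 - 1" by (simp add: eq_diff_eq)
      then have "s z = 2 * ((g z)\<^sup>2 - 1)"
        by (simp add: s_def g0)
      then show ?thesis using z by simp
    qed
    note sS = sine_addition[OF ws os]
    have s_prod: "g (x + y) = g x * g y + s x * s y / (2 * s z)" for x y
    proof -
      have "s x * (s y / 2) = s z * (g (x + y) - g x * g y)"
      proof -
        have "s y / 2 = g (y + z) - g y * g z" by (simp add: s_eq)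
        then show ?thesis using sine_exchange[of s g x y z, OF sS] by (simp only:)
      qed
      then have "g (x + y) - g x * g y = s x * s y / (2 * s z)"
        using sz by (simp add: field_simps)
      then show ?thesis by (simp add: diff_eq_eq add.commute)
    qed
    have h_mult: "h x = h z / s z * s x" for x
    proof -
      have "s u / 2 = g (u + z) - g u * g z" for u by (simp add: s_eq)
      then have "h x * (s z / 2) = h z * (s x / 2)"
        using sine_exchange[of h g x z z, OF hS] by (simp only:)
      then show ?thesis using sz by (simp add: field_simps)
    qed
    \<comment> \<open>The scalar that turns \<open>s_prod\<close> and the sine law into multiplicativity of \<open>g + c * s\<close>.\<close>
    define c where "c = csqrt (1 / (2 * s z))"
    have cc: "c * c = 1 / (2 * s z)" by (simp add: c_def flip: power2_eq_square)
    have c0: "c \<noteq> 0" using cc sz by auto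
    define m where "m = (\<lambda>x. g x + c * s x)"
    have m_minus: "m (- x) = g x - c * s x" for x by (simp add: m_def even os)
    have "m (x + y) = m x * m y" for x y
    proof -
      have "m x * m y = g x * g y + (c * c) * (s x * s y) + c * (s x * g y + g x * s y)"
        by (simp add: m_def algebra_simps)
      then show ?thesis by (simp add: cc m_def s_prod[of x y] sS[of x y])
    qed
    moreover have "m 0 = 1" using os[of 0] by (simp add: m_def g0)
    ultimately have "exponential m" by (auto simp: exponential_def fun_eq_iff intro!: exI[of _ 0])
    moreover have "2 * g x = m x + m (- x)" for x by (simp add: m_def even os)
    moreover have "f x = (f 0 / 2 + h z / (2 * s z * c)) * m x + (f 0 / 2 - h z / (2 * s z * c)) * m (- x)" for x
    proof -
      have "f x = f 0 * g x + h z / s z * s x"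
        using h_mult[of x] h_def by (metis add.commute diff_add_cancel)
      also have "\<dots> = (f 0 / 2 + h z / (2 * s z * c)) * m x + (f 0 / 2 - h z / (2 * s z * c)) * m (- x)"
        using sz c0 unfolding m_minus by (simp add: m_def field_simps)
      finally show ?thesis .
    qed
    moreover have "m x = g x + c * (g (x + z) - g (x - z))" for x by (simp add: m_def s_def)
    ultimately show ?thesis by blast
  qed
qed

section \<open>Solutions of the integral equation\<close>

text \<open>With \<open>F x w = f (x + w) + f (x - w)\<close> the equation says that integrating
  \<open>t \<mapsto> F x (y - t)\<close> gives \<open>f x * k y\<close>. Since \<open>F (x + z) w + F (x - z) w = F x (w + z) + F x (w - z)\<close>
  holds pointwise, linearity of the integral gives
  \<open>(f (x + z) + f (x - z)) * k y = f x * (k (y + z) + k (y - z))\<close>. Fixing \<open>y\<close> with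
  \<open>k y \<noteq> 0\<close> leads to Wilson's equation. Hence \<open>F x w = 2 * f x * g w\<close>, so that the given
  integrals are integrals of translates of the even function \<open>g\<close>.\<close>

lemma solves_imp_wilson:
  assumes f: "f \<noteq> (\<lambda>_. 0)" and k: "k \<noteq> (\<lambda>_. 0)" and sol: "solves A \<mu> f k"
  obtains g where "wilson g f" "\<And>y. cm_integrable A \<mu> (\<lambda>t. g (y - t))"
    "\<And>y. k y = 2 * cm_integral A \<mu> (\<lambda>t. g (y - t))"
proof -
  have int: "cm_integrable A \<mu> (\<lambda>t. f (x + y - t) + f (x - y + t))"
    and eq: "cm_integral A \<mu> (\<lambda>t. f (x + y - t) + f (x - y + t)) = f x * k y" for x y
    using sol by (auto simp: solves_def)
  have switch: "(f (x + z) + f (x - z)) * k y = f x * (k (y + z) + k (y - z))" for x y z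
  proof -
    let ?F = "\<lambda>u v t. f (u + v - t) + f (u - v + t)"
    have "(f (x + z) + f (x - z)) * k y =
        cm_integral A \<mu> (\<lambda>t. ?F (x + z) y t + ?F (x - z) y t)"
      by (subst cm_integral_add[OF int int]) (simp add: eq distrib_right)
    also have "(\<lambda>t. ?F (x + z) y t + ?F (x - z) y t) = (\<lambda>t. ?F x (y + z) t + ?F x (y - z) t)"
      by (rule ext) (simp add: algebra_simps)
    also have "cm_integral A \<mu> \<dots> = f x * (k (y + z) + k (y - z))"
      by (subst cm_integral_add[OF int int]) (simp add: eq distrib_left)
    finally show ?thesis .
  qed
  obtain y0 where y0: "k y0 \<noteq> 0" using k by auto
  obtain x0 where x0: "f x0 \<noteq> 0" using f by auto
  define g where "g = (\<lambda>z. (k (y0 + z) + k (y0 - z)) / (2 * k y0))"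
  have W: "wilson g f"
    unfolding wilson_def g_def using switch[where y = y0] y0 by (auto simp: eq_divide_eq)
  have eq': "(\<lambda>t. f (x0 + y - t) + f (x0 - y + t)) = (\<lambda>t. 2 * f x0 * g (y - t))" for y
  proof
    fix t
    show "f (x0 + y - t) + f (x0 - y + t) = 2 * f x0 * g (y - t)"
      using wilsonD[OF W, of x0 "y - t"] by (simp add: algebra_simps)
  qed
  have int_g: "cm_integrable A \<mu> (\<lambda>t. g (y - t))" for y
    using cm_integrable_mult_right[OF int[of x0 y, unfolded eq'], of "1 / (2 * f x0)"] x0 by simp
  have "k y = 2 * cm_integral A \<mu> (\<lambda>t. g (y - t))" for y
    using eq[of x0 y, unfolded eq' cm_integral_mult_right[OF int_g]] x0 by simp
  with W int_g show ?thesis using that by blast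
qed

text \<open>Wilson's equation determines \<open>f\<close>. The exponentials that occur are linear combinations of
  translates of \<open>g\<close>, hence integrable, and \<open>k y\<close> is computed by expanding
  \<open>2 * g (y - t)\<close> in terms of them.\<close>

lemma solves_imp_form:
  assumes f: "f \<noteq> (\<lambda>_. 0)" and k: "k \<noteq> (\<lambda>_. 0)" and sol: "solves A \<mu> f k"
  shows "(\<exists>m \<gamma> \<delta>. form_i A \<mu> f k m \<gamma> \<delta>) \<or> (\<exists>m0 a \<beta>. form_ii A \<mu> f k m0 a \<beta>)"
proof -
  obtain g where W: "wilson g f" and int_g: "\<And>y. cm_integrable A \<mu> (\<lambda>t. g (y - t))"
    and k_eq: "\<And>y. k y = 2 * cm_integral A \<mu> (\<lambda>t. g (y - t))"
    using solves_imp_wilson[OF assms] by blast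
  have even: "g (- x) = g x" for x by (rule wilson_imp_dalembert(3)[OF W f])
  have int_g': "cm_integrable A \<mu> (\<lambda>t. g (t + y))" for y
  proof -
    have "(\<lambda>t. g (t + y)) = (\<lambda>t. g (- y - t))"
    proof
      show "g (t + y) = g (- y - t)" for t
        by (metis even minus_add add.commute diff_conv_add_uminus)
    qed
    then show ?thesis using int_g[of "- y"] by (simp only:)
  qed
  from wilson_solution[OF W f] show ?thesis
  proof (elim disjE exE conjE)
    fix m \<gamma> \<delta> c z
    assume m: "exponential m" and f_eq: "\<forall>x. f x = \<gamma> * m x + \<delta> * m (- x)"
      and g_eq: "\<forall>x. 2 * g x = m x + m (- x)"
      and m_eq: "\<forall>x. m x = g x + c * (g (x + z) - g (x - z))"
    have "cm_integrable A \<mu> (\<lambda>t. g (t + 0) + (c * g (t + z) + (- c) * g (t + - z)))"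
      by (intro cm_integrable_add cm_integrable_mult_right int_g')
    also have "(\<lambda>t. g (t + 0) + (c * g (t + z) + (- c) * g (t + - z))) = m"
      by (simp add: fun_eq_iff m_eq[rule_format] algebra_simps)
    finally have int_m: "cm_integrable A \<mu> m" .
    have "cm_integrable A \<mu> (\<lambda>t. 2 * g (t + 0) + (-1) * m t)"
      by (intro cm_integrable_add cm_integrable_mult_right int_g' int_m)
    also have "(\<lambda>t. 2 * g (t + 0) + (-1) * m t) = check m"
      using g_eq by (simp add: fun_eq_iff check_def)
    finally have int_c: "cm_integrable A \<mu> (check m)" .
    have "k y = cm_hat A \<mu> m * m y + cm_hat A \<mu> (check m) * m (- y)" for y
    proof -
      have "k y = cm_integral A \<mu> (\<lambda>t. 2 * g (y - t))"
        by (simp add: k_eq cm_integral_mult_right[OF int_g])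
      also have "(\<lambda>t. 2 * g (y - t)) = (\<lambda>t. m y * check m t + m (- y) * m t)"
      proof
        fix t
        have "m (y - t) = m y * m (- t)" "m (t - y) = m (- y) * m t"
          using exponential_diff[OF m] by (simp_all add: mult.commute)
        then show "2 * g (y - t) = m y * check m t + m (- y) * m t"
          by (simp add: g_eq[rule_format] check_def)
      qed
      also have "cm_integral A \<mu> \<dots> = m y * cm_integral A \<mu> (check m) + m (- y) * cm_integral A \<mu> m"
        by (simp add: cm_integral_add cm_integrable_mult_right cm_integral_mult_right int_m int_c)
      finally show ?thesis by (simp add: cm_hat_def check_def algebra_simps)
    qed
    then have "form_i A \<mu> f k m \<gamma> \<delta>"
      using m int_m int_c f_eq by (simp add: form_i_def)
    then show ?thesis by blast
  next
    fix b
    assume g: "exponential g" "check g = g" and b: "Modules.additive b"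
      and f_eq: "\<forall>x. f x = (b x + f 0) * g x"
    have int: "cm_integrable A \<mu> g" using int_g'[of 0] by simp
    have k_eq': "k y = 2 * cm_hat A \<mu> g * g y" for y
    proof -
      have "(\<lambda>t. g (y - t)) = (\<lambda>t. g y * g t)"
        using exponential_diff[OF g(1)] by (simp add: even)
      then show ?thesis
        unfolding k_eq by (simp add: cm_hat_def g(2) cm_integral_mult_right[OF int])
    qed
    have nz: "cm_hat A \<mu> g \<noteq> 0" using k k_eq' by auto
    \<comment> \<open>The normalisation of \<open>form_ii\<close> divides \<open>a\<close> by \<open>2 * cm_hat A \<mu> g\<close>.\<close>
    let ?a = "\<lambda>x. 2 * cm_hat A \<mu> g * b x"
    have "Modules.additive ?a"
      using b by (simp add: Modules.additive_def algebra_simps)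
    moreover have "f x = (1 / (2 * cm_hat A \<mu> g) * ?a x + f 0) * g x" for x
    proof -
      have "1 / (2 * cm_hat A \<mu> g) * ?a x = b x" using nz by simp
      then show ?thesis by (simp only: f_eq[rule_format, of x])
    qed
    ultimately have "form_ii A \<mu> f k g ?a (f 0)"
      unfolding form_ii_def using g int nz k_eq' by (intro conjI allI)
    then show ?thesis by blast
  qed
qed

lemma form_i_solves:
  assumes "form_i A \<mu> f k m \<gamma> \<delta>"
  shows "solves A \<mu> f k"
  unfolding solves_def
proof (intro allI)
  fix x y
  from assms have m: "exponential m" and int: "cm_integrable A \<mu> m" "cm_integrable A \<mu> (check m)"
    and f: "f x = \<gamma> * m x + \<delta> * m (- x)"
    and k: "k x = cm_hat A \<mu> m * m x + cm_hat A \<mu> (check m) * m (- x)" for x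
    by (auto simp: form_i_def)
  have "(\<lambda>t. f (x + y - t) + f (x - y + t)) = (\<lambda>t. (f x * m y) * check m t + (f x * m (- y)) * m t)"
  proof
    fix t
    have mm: "m (x + y - t) = m x * m y * m (- t)" "m (x - y + t) = m x * m (- y) * m t"
      "m (- (x + y - t)) = m (- x) * m (- y) * m t" "m (- (x - y + t)) = m (- x) * m y * m (- t)"
      by (simp_all add: exponential_add[OF m, symmetric] algebra_simps)
    show "f (x + y - t) + f (x - y + t) = (f x * m y) * check m t + (f x * m (- y)) * m t"
      unfolding f check_def mm by (simp add: algebra_simps)
  qed
  moreover have "f x * k y = (f x * m y) * cm_integral A \<mu> (check m) + (f x * m (- y)) * cm_integral A \<mu> m"
    by (simp add: k cm_hat_def check_def algebra_simps)
  ultimately show "cm_integrable A \<mu> (\<lambda>t. f (x + y - t) + f (x - y + t)) \<and>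
     cm_integral A \<mu> (\<lambda>t. f (x + y - t) + f (x - y + t)) = f x * k y"
    using int
    by (simp only: cm_integrable_add cm_integral_add cm_integrable_mult_right cm_integral_mult_right simp_thms)
qed

lemma form_ii_solves:
  assumes "form_ii A \<mu> f k m0 a \<beta>"
  shows "solves A \<mu> f k"
  unfolding solves_def
proof (intro allI)
  fix x y
  define c where "c = 1 / (2 * cm_hat A \<mu> m0)"
  from assms have m: "exponential m0" and even: "check m0 = m0" and int: "cm_integrable A \<mu> m0"
    and a: "Modules.additive a"
    and f: "f x = (c * a x + \<beta>) * m0 x"
    and k: "k x = 2 * cm_hat A \<mu> m0 * m0 x" for x
    by (auto simp: form_ii_def c_def)
  have "(\<lambda>t. f (x + y - t) + f (x - y + t)) = (\<lambda>t. (2 * f x * m0 y) * m0 t)"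
  proof
    fix t
    have ev: "m0 (- u) = m0 u" for u using even by (metis check_def)
    have mm: "m0 (x + y - t) = m0 x * m0 y * m0 (- t)" "m0 (x - y + t) = m0 x * m0 (- y) * m0 t"
      by (simp_all add: exponential_add[OF m, symmetric] algebra_simps)
    have aa: "a (x + y - t) = a x + (a y - a t)" "a (x - y + t) = a x - (a y - a t)"
      using a by (simp_all add: Modules.additive.add Modules.additive.diff)
    show "f (x + y - t) + f (x - y + t) = (2 * f x * m0 y) * m0 t"
      unfolding f mm aa ev by (simp add: algebra_simps)
  qed
  then show "cm_integrable A \<mu> (\<lambda>t. f (x + y - t) + f (x - y + t)) \<and>
     cm_integral A \<mu> (\<lambda>t. f (x + y - t) + f (x - y + t)) = f x * k y"
    using int by (simp add: cm_integrable_mult_right cm_integral_mult_right k cm_hat_def even)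
qed

section \<open>Continuous functions on topological groups\<close>

lemma continuous_map_translation:
  assumes "topological_group T"
  shows "continuous_map T T (\<lambda>x. x + z)"
proof -
  have "topspace T = UNIV" and add: "continuous_map (prod_topology T T) T (\<lambda>(x, y). x + y)"
    using assms by (auto simp: topological_group_def)
  then have "continuous_map T (prod_topology T T) (\<lambda>x. (x, z))"
    by (intro continuous_map_pairedI) auto
  from continuous_map_compose[OF this add] show ?thesis by (simp add: o_def)
qed

lemma openin_translation_vimage:
  assumes "topological_group T" "openin T U"
  shows "openin T {x. x + z \<in> U}"
  using openin_continuous_map_preimage[OF continuous_map_translation[OF assms(1)] assms(2), of z] assms(1)
  by (simp add: topological_group_def)

text \<open>Sums and products of complex continuous functions on an abstract topology are all instances of
  composition with a continuous function of two complex variables.\<close>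

lemma continuous_map_combine:
  fixes h k :: "'a \<Rightarrow> complex" and F :: "complex \<times> complex \<Rightarrow> complex"
  assumes "continuous_in T h" "continuous_in T k" "continuous_on UNIV F"
  shows "continuous_in T (\<lambda>x. F (h x, k x))"
proof -
  have "continuous_map T euclidean (\<lambda>x. (h x, k x))"
    using continuous_map_pairedI[OF assms(1,2)] by (simp add: euclidean_product_topology)
  from continuous_map_compose[OF this, of euclidean F] assms(3) show ?thesis
    by (simp add: o_def)
qed

lemma continuous_in_translates:
  assumes "topological_group T" "continuous_in T h"
  shows "continuous_in T (\<lambda>x. u * h (x + z) + v * h x)"
proof -
  have "continuous_in T (\<lambda>x. h (x + z))"
    using continuous_map_compose[OF continuous_map_translation[OF assms(1)] assms(2)]
    by (simp add: o_def)
  moreover have "continuous_on UNIV (\<lambda>p::complex \<times> complex. u * fst p + v * snd p)"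
    by (intro continuous_intros)
  ultimately show ?thesis
    using continuous_map_combine[OF _ assms(2), of "\<lambda>x. h (x + z)" "\<lambda>p. u * fst p + v * snd p"]
    by simp
qed

lemma continuous_in_mult:
  fixes h k :: "'a \<Rightarrow> complex"
  assumes "continuous_in T h" "continuous_in T k"
  shows "continuous_in T (\<lambda>x. h x * k x)"
proof -
  have "continuous_on UNIV (\<lambda>p::complex \<times> complex. fst p * snd p)" by (intro continuous_intros)
  from continuous_map_combine[OF assms this] show ?thesis by simp
qed

lemma continuous_in_check:
  assumes "topological_group T" "continuous_in T h"
  shows "continuous_in T (check h)"
  using assms continuous_map_compose[of T T uminus euclidean h]
  by (simp add: topological_group_def check_def o_def)

lemma continuous_in_if_small_increments:
  assumes "topological_group T"
    and near: "\<And>x e. e > 0 \<Longrightarrow> \<exists>V. openin T V \<and> 0 \<in> V \<and> (\<forall>v\<in>V. norm (\<phi> (v + x) - \<phi> x) < e)"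
  shows "continuous_in T \<phi>"
proof -
  have top: "topspace T = UNIV" using assms(1) by (simp add: topological_group_def)
  have "openin T {x. \<phi> x \<in> W}" if W: "open W" for W
  proof (subst openin_subopen, intro ballI)
    fix x assume "x \<in> {x. \<phi> x \<in> W}"
    then obtain e where e: "e > 0" "ball (\<phi> x) e \<subseteq> W" using W by (auto simp: open_contains_ball)
    obtain V where V: "openin T V" "0 \<in> V" "\<And>v. v \<in> V \<Longrightarrow> norm (\<phi> (v + x) - \<phi> x) < e"
      using near[OF e(1), of x] by blast
    have "\<phi> y \<in> W" if "y + - x \<in> V" for y
      using V(3)[OF that] e(2) by (auto simp: dist_norm norm_minus_commute subset_iff)
    then show "\<exists>U. openin T U \<and> x \<in> U \<and> U \<subseteq> {x. \<phi> x \<in> W}"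
      using openin_translation_vimage[OF assms(1) V(1), of "- x"] V(2)
      by (intro exI[of _ "{y. y + - x \<in> V}"]) auto
  qed
  then show ?thesis by (simp add: continuous_map_def top open_openin[symmetric])
qed

section \<open>Haar measurability\<close>

lemma outer_measure_of_subadditive:
  assumes "\<And>i::nat. A i \<subseteq> space M"
  shows "outer_measure_of M (\<Union>i. A i) \<le> (\<Sum>i. outer_measure_of M (A i))"
proof -
  obtain E where E: "\<And>i. E i \<in> sets M" "\<And>i. A i \<subseteq> E i"
    "\<And>i. outer_measure_of M (A i) = emeasure M (E i)"
    using outer_measure_of_attain[OF assms] by metis
  have "outer_measure_of M (\<Union>i. A i) \<le> outer_measure_of M (\<Union>i. E i)"
    using E(2) by (intro outer_measure_of_mono) blast
  also have "\<dots> = emeasure M (\<Union>i. E i)" using E(1) by (intro outer_measure_of_eq) auto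
  also have "\<dots> \<le> (\<Sum>i. emeasure M (E i))"
    using E(1) by (intro emeasure_subadditive_countably) auto
  finally show ?thesis by (simp add: E(3))
qed

lemma sigma_algebra_caratheodory:
  assumes "space M = UNIV"
  shows "sigma_algebra UNIV (lambda_system UNIV (Pow UNIV) (outer_measure_of M))"
proof -
  interpret sigma_algebra UNIV "Pow UNIV :: 'a set set" by (rule sigma_algebra_Pow)
  have "outer_measure_space (Pow UNIV) (outer_measure_of M)"
    unfolding outer_measure_space_def positive_def increasing_def countably_subadditive_def
  proof (intro conjI allI impI ballI)
    show "outer_measure_of M {} = 0" by simp
  qed (auto intro: outer_measure_of_mono outer_measure_of_subadditive simp: assms)
  from caratheodory_lemma[OF this] show ?thesis by (simp add: measure_space_def)
qed

text \<open>Caratheodory's sets for the outer Haar measure.\<close>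

definition haar_sets :: "'a measure \<Rightarrow> 'a set set" where
  "haar_sets H = lambda_system UNIV (Pow UNIV) (outer_measure_of H)"

lemma haar_sets_iff:
  "P \<in> haar_sets H \<longleftrightarrow> (\<forall>X. outer_measure_of H (X \<inter> P) + outer_measure_of H (X - P) = outer_measure_of H X)"
  by (auto simp: haar_sets_def lambda_system_def Int_commute Diff_eq)

lemma haar_measurable_iff:
  assumes "space H = UNIV"
  shows "haar_measurable H f \<longleftrightarrow> (\<forall>B\<in>sets borel. f -` B \<in> haar_sets H)"
proof -
  interpret sigma_algebra UNIV "haar_sets H"
    unfolding haar_sets_def by (rule sigma_algebra_caratheodory[OF assms])
  show ?thesis
    unfolding haar_measurable_def haar_sets_def[symmetric]
    by (simp add: measurable_def sigma_sets_eq)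
qed

lemma haar_measureD:
  assumes "haar_measure T H"
  shows "space H = UNIV" "openin T U \<Longrightarrow> U \<in> sets H" "emeasure H UNIV \<noteq> 0"
    "compactin T K \<Longrightarrow> emeasure H K < \<infinity>"
    "E \<in> sets H \<Longrightarrow> emeasure H E = (INF U\<in>{U. openin T U \<and> E \<subseteq> U}. emeasure H U)"
    "openin T U \<Longrightarrow> emeasure H U = (SUP K\<in>{K. compactin T K \<and> K \<subseteq> U}. emeasure H K)"
    "E \<in> sets H \<Longrightarrow> emeasure H ((\<lambda>y. x + y) ` E) = emeasure H E"
  using assms by (auto simp: haar_measure_def)

lemma compactin_haar_sets:
  assumes "topological_group T" "Hausdorff_space T" "haar_measure T H" "compactin T K"
  shows "K \<in> sets H"
proof -
  have "closedin T K" by (rule compactin_imp_closedin[OF assms(2,4)])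
  then have "openin T (UNIV - K)" using assms(1) by (simp add: topological_group_def closedin_def)
  from sets.compl_sets[OF haar_measureD(2)[OF assms(3) this]] show ?thesis
    by (simp add: haar_measureD(1)[OF assms(3)] double_diff)
qed

text \<open>By outer regularity, the outer measure may be computed from open supersets alone. Open sets are
  translated to open sets, which makes translation invariance immediate.\<close>

lemma outer_measure_of_haar:
  assumes "haar_measure T H"
  shows "outer_measure_of H X = (INF U\<in>{U. openin T U \<and> X \<subseteq> U}. emeasure H U)"
proof (rule antisym)
  show "outer_measure_of H X \<le> (INF U\<in>{U. openin T U \<and> X \<subseteq> U}. emeasure H U)"
    unfolding outer_measure_of_def
    using haar_measureD(2)[OF assms] by (intro INF_superset_mono) auto
next
  show "(INF U\<in>{U. openin T U \<and> X \<subseteq> U}. emeasure H U) \<le> outer_measure_of H X"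
    unfolding outer_measure_of_def
  proof (rule INF_greatest)
    fix B assume B: "B \<in> {B \<in> sets H. X \<subseteq> B}"
    then have "emeasure H B = (INF U\<in>{U. openin T U \<and> B \<subseteq> U}. emeasure H U)"
      using haar_measureD(5)[OF assms] by blast
    then show "(INF U\<in>{U. openin T U \<and> X \<subseteq> U}. emeasure H U) \<le> emeasure H B"
      using B by (auto intro: INF_superset_mono)
  qed
qed

lemma outer_measure_of_translation_le:
  assumes "topological_group T" "haar_measure T H"
  shows "outer_measure_of H {x. x + z \<in> X} \<le> outer_measure_of H X"
  unfolding outer_measure_of_haar[OF assms(2), of X]
proof (rule INF_greatest)
  fix U assume "U \<in> {U. openin T U \<and> X \<subseteq> U}"
  then have U: "openin T U" "X \<subseteq> U" by auto
  have eq: "{x. x + z \<in> U} = (\<lambda>y. - z + y) ` U"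
    by (force simp: image_iff algebra_simps)
  have "outer_measure_of H {x. x + z \<in> X} \<le> outer_measure_of H {x. x + z \<in> U}"
    using U(2) by (intro outer_measure_of_mono) auto
  also have "\<dots> = emeasure H {x. x + z \<in> U}"
    by (intro outer_measure_of_eq haar_measureD(2)[OF assms(2)] openin_translation_vimage assms U)
  also have "\<dots> = emeasure H U"
    unfolding eq by (intro haar_measureD(7)[OF assms(2)] haar_measureD(2)[OF assms(2)] U)
  finally show "outer_measure_of H {x. x + z \<in> X} \<le> emeasure H U" .
qed

lemma outer_measure_of_translation:
  assumes "topological_group T" "haar_measure T H"
  shows "outer_measure_of H {x. x + z \<in> X} = outer_measure_of H X"
proof (rule antisym[OF outer_measure_of_translation_le[OF assms]])
  show "outer_measure_of H X \<le> outer_measure_of H {x. x + z \<in> X}"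
    using outer_measure_of_translation_le[OF assms, of "- z" "{x. x + z \<in> X}"] by simp
qed

lemma haar_sets_translation:
  assumes "topological_group T" "haar_measure T H" "P \<in> haar_sets H"
  shows "{x. x + z \<in> P} \<in> haar_sets H"
  unfolding haar_sets_iff
proof
  fix X
  let ?Y = "{x. x + - z \<in> X}"
  have "X \<inter> {x. x + z \<in> P} = {x. x + z \<in> ?Y \<inter> P}" "X - {x. x + z \<in> P} = {x. x + z \<in> ?Y - P}"
    by auto
  moreover have "outer_measure_of H (?Y \<inter> P) + outer_measure_of H (?Y - P) = outer_measure_of H ?Y"
    using assms(3) unfolding haar_sets_iff by blast
  ultimately show "outer_measure_of H (X \<inter> {x. x + z \<in> P}) + outer_measure_of H (X - {x. x + z \<in> P}) = outer_measure_of H X"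
    by (simp only: outer_measure_of_translation[OF assms(1,2)])
qed

lemma haar_measurable_translates:
  assumes "topological_group T" "haar_measure T H" "haar_measurable H h"
  shows "haar_measurable H (\<lambda>x. u * h (x + z) + v * h x)"
proof -
  note sp = haar_measureD(1)[OF assms(2)]
  have "haar_measurable H (\<lambda>x. h (x + z))"
    unfolding haar_measurable_iff[OF sp]
  proof
    fix B :: "complex set" assume "B \<in> sets borel"
    then have "h -` B \<in> haar_sets H" using assms(3) by (simp add: haar_measurable_iff[OF sp])
    from haar_sets_translation[OF assms(1,2) this, of z]
    show "(\<lambda>x. h (x + z)) -` B \<in> haar_sets H" by (simp add: vimage_def)
  qed
  then show ?thesis
    using assms(3) unfolding haar_measurable_def
    by (intro borel_measurable_add borel_measurable_times borel_measurable_const)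
qed

text \<open>Shrink \<open>K \<inter> P\<close> to a compact set \<open>C\<close> of positive measure by removing from \<open>K\<close>
  an open set that covers \<open>K - P\<close> with little excess. An open \<open>U\<close> around \<open>C\<close> of measure less than twice that of \<open>C\<close>
  contains \<open>v + C\<close> for all \<open>v\<close> near zero, by compactness, and there is not enough room in \<open>U\<close> for
  \<open>v + C\<close> and \<open>C\<close> to be disjoint.\<close>

lemma steinhaus:
  assumes "topological_group T" "Hausdorff_space T" "haar_measure T H"
    and P: "P \<in> haar_sets H" and K: "compactin T K" and pos: "outer_measure_of H (K \<inter> P) > 0"
  shows "\<exists>V. openin T V \<and> 0 \<in> V \<and> (\<forall>v\<in>V. \<exists>q\<in>P. v + q \<in> P)"
proof -
  note HD = haar_measureD[OF assms(3)]
  have top: "topspace T = UNIV" and add: "continuous_map (prod_topology T T) T (\<lambda>(x, y). x + y)"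
    using assms(1) by (auto simp: topological_group_def)
  let ?o = "outer_measure_of H"
  have Ks: "K \<in> sets H" by (rule compactin_haar_sets[OF assms(1-3) K])
  have fin: "?o (K - P) < \<infinity>"
    using HD(4)[OF K] outer_measure_of_mono[of "K - P" K H] Ks by (simp add: le_less_trans)
  have "?o (K - P) < ?o (K - P) + ?o (K \<inter> P)"
    using pos fin by (simp add: ennreal_add_left_cancel_less)
  then obtain O' where O: "openin T O'" "K - P \<subseteq> O'" "emeasure H O' < ?o (K - P) + ?o (K \<inter> P)"
    unfolding outer_measure_of_haar[OF assms(3), of "K - P"] INF_less_iff by auto
  let ?C = "K - O'"
  have C: "compactin T ?C"
  proof -
    have "closedin T (topspace T - O')" using O(1) by blast
    from closed_Int_compactin[OF this K] have "compactin T ((topspace T - O') \<inter> K)" .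
    moreover have "(topspace T - O') \<inter> K = ?C" by (auto simp: top)
    ultimately show ?thesis by simp
  qed
  have "?C \<subseteq> P" using O(2) by blast
  have Cs: "?C \<in> sets H" by (rule compactin_haar_sets[OF assms(1-3) C])
  \<comment> \<open>\<open>P\<close> splits the outer measure of \<open>O'\<close>, so the excess of \<open>O'\<close> bounds what it takes from \<open>P\<close>.\<close>
  have "?o (O' \<inter> P) + ?o (K - P) \<le> ?o (O' \<inter> P) + ?o (O' - P)"
    using O(2) by (intro add_left_mono outer_measure_of_mono) auto
  also have "\<dots> = ?o O'" using P unfolding haar_sets_iff by blast
  also have "\<dots> < ?o (K \<inter> P) + ?o (K - P)" using O(3) HD(2)[OF O(1)] by (simp add: add.commute)
  finally have lt: "?o (O' \<inter> P) < ?o (K \<inter> P)"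
    using fin by (meson add_right_mono leD leI)
  have "emeasure H ?C \<noteq> 0"
  proof
    assume 0: "emeasure H ?C = 0"
    obtain E where E: "E \<in> sets H" "O' \<inter> P \<subseteq> E" "?o (O' \<inter> P) = emeasure H E"
      using outer_measure_of_attain[of "O' \<inter> P" H] HD(1) by auto
    have "?o (K \<inter> P) \<le> ?o (?C \<union> E)" using E(2) by (intro outer_measure_of_mono) auto
    also have "\<dots> = emeasure H (?C \<union> E)" using Cs E(1) by (intro outer_measure_of_eq) auto
    also have "\<dots> \<le> emeasure H ?C + emeasure H E" by (rule emeasure_subadditive[OF Cs E(1)])
    also have "\<dots> = ?o (O' \<inter> P)" by (simp add: 0 E(3))
    finally show False using lt by simp
  qed
  moreover have Cfin: "emeasure H ?C < \<infinity>" by (rule HD(4)[OF C])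
  ultimately have "emeasure H ?C < emeasure H ?C + emeasure H ?C"
    using ennreal_add_left_cancel_less[of "emeasure H ?C" 0] by (simp add: zero_less_iff_neq_zero)
  then obtain U where U: "openin T U" "?C \<subseteq> U" "emeasure H U < emeasure H ?C + emeasure H ?C"
    unfolding HD(5)[OF Cs] INF_less_iff by auto
  have W: "openin (prod_topology T T) {p. fst p + snd p \<in> U}"
    using openin_continuous_map_preimage[OF add U(1)] top
    by (simp add: case_prod_unfold)
  have "compactin T {0}" by (simp add: top)
  moreover have "{0} \<times> ?C \<subseteq> {p. fst p + snd p \<in> U}" using U(2) by auto
  ultimately obtain V Y where V: "openin T V" "openin T Y" "{0} \<subseteq> V" "?C \<subseteq> Y"
    and VY: "V \<times> Y \<subseteq> {p. fst p + snd p \<in> U}"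
    by (rule Wallace_theorem_prod_topology[OF _ C W])
  have VC: "v + y \<in> U" if "v \<in> V" "y \<in> ?C" for v y
  proof -
    have "(v, y) \<in> V \<times> Y" using that V(4) by auto
    from subsetD[OF VY this] show ?thesis by simp
  qed
  have "\<exists>q\<in>P. v + q \<in> P" if v: "v \<in> V" for v
  proof (rule ccontr)
    assume neg: "\<not> (\<exists>q\<in>P. v + q \<in> P)"
    let ?vC = "(\<lambda>y. v + y) ` ?C"
    have disj: "?vC \<inter> ?C = {}" using neg \<open>?C \<subseteq> P\<close> by blast
    have "continuous_map T T (\<lambda>y. v + y)"
      using continuous_map_translation[OF assms(1), of v] by (simp add: add.commute)
    then have "compactin T ?vC" by (rule image_compactin[OF C])
    then have vCs: "?vC \<in> sets H" by (rule compactin_haar_sets[OF assms(1-3)])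
    have "emeasure H ?C + emeasure H ?C = emeasure H ?vC + emeasure H ?C"
      by (simp add: HD(7)[OF Cs])
    also have "\<dots> = emeasure H (?vC \<union> ?C)" by (rule plus_emeasure[OF vCs Cs disj])
    also have "\<dots> \<le> emeasure H U"
      using VC v U(2) by (intro emeasure_mono HD(2)[OF U(1)]) auto
    finally show False using U(3) by simp
  qed
  then show ?thesis using V(1,3) by blast
qed

lemma ex_compact_positive_measure:
  assumes "topological_group T" "haar_measure T H"
  obtains K where "compactin T K" "emeasure H K > 0"
proof -
  have "openin T UNIV" using assms(1) openin_topspace[of T] by (simp add: topological_group_def)
  then have "(SUP K\<in>{K. compactin T K \<and> K \<subseteq> UNIV}. emeasure H K) \<noteq> 0"
    using haar_measureD(3,6)[OF assms(2)] by metis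
  then have "0 < (SUP K\<in>{K. compactin T K \<and> K \<subseteq> UNIV}. emeasure H K)"
    by (simp add: zero_less_iff_neq_zero)
  then show ?thesis using that unfolding less_SUP_iff by blast
qed

text \<open>Finitely many translates of a nonempty open set cover a compact set of positive measure.\<close>

lemma haar_null_open_empty:
  assumes "topological_group T" "haar_measure T H"
    and U: "openin T U" "emeasure H U = 0"
  shows "U = {}"
proof (rule ccontr)
  assume "U \<noteq> {}"
  then obtain u where u: "u \<in> U" by blast
  obtain K where K: "compactin T K" "emeasure H K > 0"
    using ex_compact_positive_measure[OF assms(1,2)] by blast
  let ?U = "\<lambda>x. {y. y + (u - x) \<in> U}"
  have op: "openin T (?U x)" for x by (rule openin_translation_vimage[OF assms(1) U(1)])
  have null: "?U x \<in> null_sets H" for x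
  proof -
    have "outer_measure_of H (?U x) = outer_measure_of H U"
      by (rule outer_measure_of_translation[OF assms(1,2)])
    then show ?thesis using haar_measureD(2)[OF assms(2)] op U by (auto intro!: null_setsI)
  qed
  have "x \<in> ?U x" for x using u by simp
  then have "K \<subseteq> \<Union> (range ?U)" by blast
  then obtain F where F: "finite F" "F \<subseteq> range ?U" "K \<subseteq> \<Union> F"
    using K(1) op unfolding compactin_def by (metis (no_types, lifting) image_iff)
  have "\<Union> F \<in> null_sets H"
    using F(1,2) null null_sets_UN'[of F "\<lambda>x. x" H] by (auto intro: countable_finite)
  then have "emeasure H K \<le> 0"
    using emeasure_mono[OF F(3), of H] by (auto simp: null_sets_def)
  then show False using K(2) by simp
qed

text \<open>Countably many open squares \<open>N \<times> N \<subseteq> D\<close> cover the diagonal over the range of \<open>\<phi>\<close>, so some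
  preimage of an \<open>N\<close> meets a compact set in positive outer measure, and Steinhaus's theorem
  applies to that preimage. Leaving \<open>D\<close> general serves homomorphisms into the additive group,
  where nearness is measured by differences, and into the multiplicative group, where it is
  measured by quotients.\<close>

lemma haar_measurable_near_diagonal:
  fixes \<phi> :: "'a::ab_group_add \<Rightarrow> complex"
  assumes "topological_group T" "Hausdorff_space T" "haar_measure T H" "haar_measurable H \<phi>"
    and D: "open D" "\<And>x. (\<phi> x, \<phi> x) \<in> D"
  shows "\<exists>V. openin T V \<and> 0 \<in> V \<and> (\<forall>v\<in>V. \<exists>q. (\<phi> (v + q), \<phi> q) \<in> D)"
proof -
  obtain K where K: "compactin T K" "emeasure H K > 0"
    using ex_compact_positive_measure[OF assms(1,3)] by blast
  note sp = haar_measureD(1)[OF assms(3)]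
  let ?F = "{N. open N \<and> N \<times> N \<subseteq> D}"
  obtain F where F: "F \<subseteq> ?F" "countable F" "\<Union> F = \<Union> ?F"
    using Lindelof[of ?F] by blast
  have cover: "\<exists>N\<in>F. \<phi> x \<in> N" for x
  proof -
    obtain A B where "open A" "open B" "(\<phi> x, \<phi> x) \<in> A \<times> B" "A \<times> B \<subseteq> D"
      using open_prod_elim[OF D(1) D(2)[of x]] by metis
    then have "A \<inter> B \<in> ?F" "\<phi> x \<in> A \<inter> B" by auto
    then have "\<phi> x \<in> \<Union> F" unfolding F(3) by blast
    then show ?thesis by blast
  qed
  then have "F \<noteq> {}" by blast
  define N where "N = from_nat_into F"
  have N: "range N = F" using \<open>F \<noteq> {}\<close> F(2) by (simp add: N_def range_from_nat_into)
  have "\<exists>i. outer_measure_of H (K \<inter> \<phi> -` N i) > 0"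
  proof (rule ccontr)
    assume "\<not> ?thesis"
    then have 0: "outer_measure_of H (K \<inter> \<phi> -` N i) = 0" for i by (simp add: zero_less_iff_neq_zero)
    have "K = (\<Union>i. K \<inter> \<phi> -` N i)" using cover N by blast
    then have "outer_measure_of H K \<le> (\<Sum>i. outer_measure_of H (K \<inter> \<phi> -` N i))"
      using outer_measure_of_subadditive[of "\<lambda>i. K \<inter> \<phi> -` N i" H] by (simp add: sp)
    then show False
      using K(2) compactin_haar_sets[OF assms(1-3) K(1)] by (simp add: 0)
  qed
  then obtain i where i: "outer_measure_of H (K \<inter> \<phi> -` N i) > 0" by blast
  have "N i \<in> F" using N by blast
  then have Ni: "open (N i)" "N i \<times> N i \<subseteq> D" using F(1) by auto
  then have "\<phi> -` N i \<in> haar_sets H"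
    using assms(4) by (simp add: haar_measurable_iff[OF sp])
  then obtain V where V: "openin T V" "0 \<in> V" "\<And>v. v \<in> V \<Longrightarrow> \<exists>q\<in>\<phi> -` N i. v + q \<in> \<phi> -` N i"
    using steinhaus[OF assms(1-3) _ K(1) i] by metis
  have "\<exists>q. (\<phi> (v + q), \<phi> q) \<in> D" if v: "v \<in> V" for v
  proof -
    obtain q where "\<phi> (v + q) \<in> N i" "\<phi> q \<in> N i" using V(3)[OF v] by auto
    then show ?thesis using Ni(2) by blast
  qed
  with V(1,2) show ?thesis by blast
qed

lemma haar_measurable_exponential_continuous:
  assumes "topological_group T" "Hausdorff_space T" "haar_measure T H"
    and "haar_measurable H m" and m: "exponential m"
  shows "continuous_in T m"
proof (rule continuous_in_if_small_increments[OF assms(1)])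
  fix x and e :: real assume "e > 0"
  note nz = exponential_nonzero[OF m]
  \<comment> \<open>The increments of \<open>m\<close> at \<open>x\<close> are those at zero, scaled by \<open>m x\<close>.\<close>
  define d where "d = e / norm (m x)"
  have "d > 0" using \<open>e > 0\<close> nz by (simp add: d_def)
  let ?D = "{p::complex \<times> complex. norm (fst p - snd p) < d * norm (snd p)}"
  have "open ?D" by (intro open_Collect_less continuous_intros)
  moreover have "(m y, m y) \<in> ?D" for y using \<open>d > 0\<close> nz by simp
  ultimately obtain V where V: "openin T V" "0 \<in> V" "\<And>v. v \<in> V \<Longrightarrow> \<exists>q. (m (v + q), m q) \<in> ?D"
    using haar_measurable_near_diagonal[OF assms(1-4), of ?D] by blast
  have "norm (m (v + x) - m x) < e" if "v \<in> V" for v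
  proof -
    have split: "norm (m (v + y) - m y) = norm (m v - 1) * norm (m y)" for y
      by (simp add: exponential_add[OF m] left_diff_distrib flip: norm_mult)
    obtain q where "norm (m (v + q) - m q) < d * norm (m q)" using V(3)[OF \<open>v \<in> V\<close>] by auto
    then have "norm (m v - 1) < d" using nz[of q] by (simp add: split)
    then show ?thesis using nz[of x] unfolding split by (simp add: d_def field_simps)
  qed
  then show "\<exists>V. openin T V \<and> 0 \<in> V \<and> (\<forall>v\<in>V. norm (m (v + x) - m x) < e)" using V by blast
qed

lemma haar_measurable_additive_continuous:
  assumes "topological_group T" "Hausdorff_space T" "haar_measure T H"
    and "haar_measurable H a" and a: "Modules.additive a"
  shows "continuous_in T a"
proof (rule continuous_in_if_small_increments[OF assms(1)])
  fix x and e :: real assume "e > 0"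
  let ?D = "{p::complex \<times> complex. norm (fst p - snd p) < e}"
  have "open ?D" by (intro open_Collect_less continuous_intros)
  moreover have "(a y, a y) \<in> ?D" for y using \<open>e > 0\<close> by simp
  ultimately obtain V where V: "openin T V" "0 \<in> V" "\<And>v. v \<in> V \<Longrightarrow> \<exists>q. (a (v + q), a q) \<in> ?D"
    using haar_measurable_near_diagonal[OF assms(1-4), of ?D] by blast
  have "norm (a (v + x) - a x) < e" if "v \<in> V" for v
    using V(3)[OF that] by (simp add: Modules.additive.add[OF a])
  then show "\<exists>V. openin T V \<and> 0 \<in> V \<and> (\<forall>v\<in>V. norm (a (v + x) - a x) < e)" using V by blast
qed

lemma ess_bounded_continuous_imp_bounded:
  assumes "topological_group T" "Hausdorff_space T" "haar_measure T H"
    and "ess_bounded H h" "continuous_in T h"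
  shows "bounded (range h)"
proof -
  obtain C where "AE x in H. norm (h x) \<le> C" using assms(4) by (auto simp: ess_bounded_def)
  then obtain N where N: "{x \<in> space H. \<not> norm (h x) \<le> C} \<subseteq> N" "emeasure H N = 0" "N \<in> sets H"
    by (rule AE_E)
  let ?U = "{x. h x \<in> {w. C < norm w}}"
  have "open {w::complex. C < norm w}" by (intro open_Collect_less continuous_intros)
  then have U: "openin T ?U"
    using openin_continuous_map_preimage[OF assms(5), of "{w. C < norm w}"] assms(1)
    by (simp add: topological_group_def)
  have "?U \<subseteq> N" using N(1) by (auto simp: haar_measureD(1)[OF assms(3)] not_le)
  then have "emeasure H ?U = 0" using emeasure_mono[of ?U N H] N(2,3) by simp
  then have "?U = {}" by (rule haar_null_open_empty[OF assms(1,3) U])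
  then show ?thesis by (auto simp: bounded_iff not_less intro!: exI[of _ C])
qed

section \<open>Recovering the exponential from a solution\<close>

text \<open>A translate of \<open>\<gamma> * m x + \<delta> * m (- x)\<close> by \<open>z\<close> has coefficients \<open>\<gamma> * m z\<close> and
  \<open>\<delta> * m (- z)\<close>, so combining it with the function itself eliminates either term as soon as
  \<open>m z \<noteq> m (- z)\<close>. The predicate \<open>P\<close> will be continuity, Haar measurability and
  boundedness. It is required to be stable under translations only, because for Haar
  measure the invariance under \<open>x \<mapsto> - x\<close>, unlike that under translations, would rest on a
  uniqueness theorem. This is why the conclusion is a disjunction.\<close>

lemma exponential_pair_component:
  fixes h m :: "'a::ab_group_add \<Rightarrow> complex"
  assumes closed: "\<And>h u v z. P h \<Longrightarrow> P (\<lambda>x. u * h (x + z) + v * h x)"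
    and m: "exponential m" and h: "\<And>x. h x = \<gamma> * m x + \<delta> * m (- x)" and nz: "h \<noteq> (\<lambda>_. 0)" and "P h"
  shows "P m \<or> P (check m)"
proof (cases "\<forall>x. m (- x) = m x")
  case True
  then have h': "h x = (\<gamma> + \<delta>) * m x" for x by (simp add: h distrib_right)
  then have "\<gamma> + \<delta> \<noteq> 0" using nz by auto
  then have "(\<lambda>x. (1 / (\<gamma> + \<delta>)) * h (x + 0) + 0 * h x) = m" by (simp add: h' fun_eq_iff)
  with closed[OF \<open>P h\<close>, of "1 / (\<gamma> + \<delta>)" 0 0] show ?thesis by simp
next
  case False
  then obtain z where z: "m z - m (- z) \<noteq> 0" by (metis eq_iff_diff_eq_0)
  have mm: "m (x + z) = m x * m z" "m (- (x + z)) = m (- x) * m (- z)" for x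
    using exponential_add[OF m] by (simp_all add: exponential_add[OF m, symmetric] algebra_simps)
  have "\<gamma> \<noteq> 0 \<or> \<delta> \<noteq> 0" using nz h by auto
  then show ?thesis
  proof
    assume "\<gamma> \<noteq> 0"
    define u where "u = 1 / (\<gamma> * (m z - m (- z)))"
    have "u * h (x + z) + (- m (- z) * u) * h x = m x" for x
    proof -
      have "u * h (x + z) + (- m (- z) * u) * h x = u * (\<gamma> * (m z - m (- z))) * m x"
        unfolding h mm by (simp add: algebra_simps)
      then show ?thesis using z \<open>\<gamma> \<noteq> 0\<close> by (simp add: u_def)
    qed
    with closed[OF \<open>P h\<close>, of u z "- m (- z) * u"] show ?thesis by simp
  next
    assume "\<delta> \<noteq> 0"
    define u where "u = - 1 / (\<delta> * (m z - m (- z)))"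
    have "u * h (x + z) + (- m z * u) * h x = m (- x)" for x
    proof -
      have "u * h (x + z) + (- m z * u) * h x = - u * (\<delta> * (m z - m (- z))) * m (- x)"
        unfolding h mm by (simp add: algebra_simps)
      then show ?thesis using z \<open>\<delta> \<noteq> 0\<close> by (simp add: u_def)
    qed
    with closed[OF \<open>P h\<close>, of u z "- m z * u"] show ?thesis by (simp add: check_def)
  qed
qed

text \<open>A translate of \<open>(a + \<beta>) * m\<close> by \<open>z\<close> is, up to the factor \<open>m z\<close>, the function itself plus
  \<open>a z * m\<close>.\<close>

lemma exponential_affine_component:
  fixes h m :: "'a::ab_group_add \<Rightarrow> complex"
  assumes closed: "\<And>h u v z. P h \<Longrightarrow> P (\<lambda>x. u * h (x + z) + v * h x)"
    and m: "exponential m" and a: "Modules.additive a"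
    and h: "\<And>x. h x = (a x + \<beta>) * m x" and nz: "h \<noteq> (\<lambda>_. 0)" and "P h"
  shows "P m"
proof (cases "\<forall>x. a x = 0")
  case True
  then have "\<beta> \<noteq> 0" using nz h by auto
  then have "(\<lambda>x. (1 / \<beta>) * h (x + 0) + 0 * h x) = m" by (simp add: h True fun_eq_iff)
  with closed[OF \<open>P h\<close>, of "1 / \<beta>" 0 0] show ?thesis by simp
next
  case False
  then obtain z where z: "a z \<noteq> 0" by blast
  have "1 / (m z * a z) * h (x + z) + (- 1 / a z) * h x = m x" for x
  proof -
    have "h (x + z) = m z * (h x + a z * m x)"
      unfolding h exponential_add[OF m] Modules.additive.add[OF a] by (simp add: algebra_simps)
    then show ?thesis using z exponential_nonzero[OF m, of z] by (simp add: field_simps)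
  qed
  with closed[OF \<open>P h\<close>, of "1 / (m z * a z)" z "- 1 / a z"] show ?thesis by simp
qed

lemma form_i_component:
  assumes "\<And>h u v z. P h \<Longrightarrow> P (\<lambda>x. u * h (x + z) + v * h x)"
    and "form_i A \<mu> f k m \<gamma> \<delta>" "f \<noteq> (\<lambda>_. 0)" "k \<noteq> (\<lambda>_. 0)" "P f \<or> P k"
  shows "P m \<or> P (check m)"
  using assms(2-5) exponential_pair_component[of P m f \<gamma> \<delta>, OF assms(1)]
    exponential_pair_component[of P m k "cm_hat A \<mu> m" "cm_hat A \<mu> (check m)", OF assms(1)]
  unfolding form_i_def by blast

lemma form_ii_component:
  assumes "\<And>h u v z. P h \<Longrightarrow> P (\<lambda>x. u * h (x + z) + v * h x)"
    and form: "form_ii A \<mu> f k m0 a \<beta>" and "f \<noteq> (\<lambda>_. 0)" "k \<noteq> (\<lambda>_. 0)" "P f \<or> P k"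
  shows "P m0"
proof -
  let ?c = "1 / (2 * cm_hat A \<mu> m0)"
  have m: "exponential m0" and a: "Modules.additive (\<lambda>x. ?c * a x)" "Modules.additive (\<lambda>x. 0)"
    and fk: "\<And>x. f x = (?c * a x + \<beta>) * m0 x" "\<And>x. k x = (0 + 2 * cm_hat A \<mu> m0) * m0 x"
    using form by (auto simp: form_ii_def Modules.additive_def add_divide_distrib)
  from assms(5) show ?thesis
    using exponential_affine_component[of P, OF assms(1) m a(1) fk(1) assms(3)]
      exponential_affine_component[of P, OF assms(1) m a(2) fk(2) assms(4)] by blast
qed

lemma bounded_translates:
  fixes h :: "'a::ab_group_add \<Rightarrow> complex"
  assumes "bounded (range h)"
  shows "bounded (range (\<lambda>x. u * h (x + z) + v * h x))"
proof -
  obtain C where C: "\<And>x. norm (h x) \<le> C" using assms by (auto simp: bounded_iff)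
  have "norm (u * h (x + z) + v * h x) \<le> norm u * C + norm v * C" for x
    by (intro norm_triangle_mono) (auto simp: norm_mult C mult_left_mono)
  then show ?thesis by (auto simp: bounded_iff)
qed

text \<open>The powers \<open>m x ^ n = m (n x)\<close> are bounded only if \<open>norm (m x) \<le> 1\<close>; the same
  holds at \<open>- x\<close>, where the value is the reciprocal.\<close>

lemma bounded_exponential_norm_1:
  assumes m: "exponential m" and "bounded (range m)"
  shows "norm (m x) = 1"
proof -
  obtain C where C: "\<And>x. norm (m x) \<le> C" using assms(2) by (auto simp: bounded_iff)
  have le: "norm (m x) \<le> 1" for x
  proof (rule ccontr)
    assume "\<not> norm (m x) \<le> 1"
    then obtain n where n: "C < norm (m x) ^ n" using real_arch_pow[of "norm (m x)" C] by auto
    have "\<exists>y. m y = m x ^ n" for n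
    proof (induction n)
      case 0
      then show ?case using exponential_zero[OF m] by auto
    next
      case (Suc n)
      then obtain y where "m y = m x ^ n" by blast
      then have "m (x + y) = m x ^ Suc n" by (simp add: exponential_add[OF m])
      then show ?case by blast
    qed
    then obtain y where "m y = m x ^ n" by blast
    then show False using C[of y] n by (simp add: norm_power)
  qed
  have "norm (m x) * norm (m (- x)) = 1"
    using exponential_minus[OF m, of x] by (simp flip: norm_mult)
  then show ?thesis
    using le[of x] le[of "- x"] mult_left_le[of "norm (m (- x))" "norm (m x)"] by simp
qed

lemma bounded_additive_zero:
  fixes a :: "'a::ab_group_add \<Rightarrow> complex"
  assumes a: "Modules.additive a" and "bounded (range a)"
  shows "a x = 0"
proof (rule ccontr)
  assume "a x \<noteq> 0"
  obtain C where C: "\<And>x. norm (a x) \<le> C" using assms(2) by (auto simp: bounded_iff)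
  obtain n where n: "C < real n * norm (a x)"
    using \<open>a x \<noteq> 0\<close> reals_Archimedean3[of "norm (a x)"] by auto
  have "\<exists>y. a y = of_nat n * a x" for n
  proof (induction n)
    case 0
    then show ?case using Modules.additive.zero[OF a] by auto
  next
    case (Suc n)
    then obtain y where "a y = of_nat n * a x" by blast
    then have "a (x + y) = of_nat (Suc n) * a x" by (simp add: Modules.additive.add[OF a] algebra_simps)
    then show ?case by blast
  qed
  then obtain y where "a y = of_nat n * a x" by blast
  then show False using C[of y] n by (simp add: norm_mult)
qed

section \<open>Regularity of the solutions\<close>

lemma form_i_continuous:
  assumes "topological_group T" "form_i A \<mu> f k m \<gamma> \<delta>" "continuous_in T m"
  shows "continuous_in T f" "continuous_in T k"
proof -
  have lin: "continuous_in T (\<lambda>x. c * m x + d * m (- x))" for c d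
  proof -
    have "continuous_on UNIV (\<lambda>p::complex \<times> complex. c * fst p + d * snd p)"
      by (intro continuous_intros)
    from continuous_map_combine[OF assms(3) continuous_in_check[OF assms(1,3)] this]
    show ?thesis by (simp add: check_def)
  qed
  have "f = (\<lambda>x. \<gamma> * m x + \<delta> * m (- x))"
    "k = (\<lambda>x. cm_hat A \<mu> m * m x + cm_hat A \<mu> (check m) * m (- x))"
    using assms(2) by (auto simp: form_i_def)
  then show "continuous_in T f" "continuous_in T k" using lin by metis+
qed

text \<open>An even exponential satisfies \<open>m0 x * m0 x = 1\<close>, so dividing by it is multiplying by it, and
  \<open>a\<close> is a polynomial expression in \<open>f\<close> and \<open>m0\<close>.\<close>

lemma form_ii_additive_eq:
  assumes "form_ii A \<mu> f k m0 a \<beta>"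
  shows "a = (\<lambda>x. 2 * cm_hat A \<mu> m0 * (f x * m0 x - \<beta>))"
proof
  fix x
  have "m0 (- x) = m0 x" and m: "exponential m0" and nz: "cm_hat A \<mu> m0 \<noteq> 0"
    and f: "f x = (1 / (2 * cm_hat A \<mu> m0) * a x + \<beta>) * m0 x"
    using assms by (auto simp: form_ii_def check_def dest: fun_cong[of _ _ x])
  then have "m0 x * m0 x = 1" using exponential_minus[OF m, of x] by simp
  then have "f x * m0 x = 1 / (2 * cm_hat A \<mu> m0) * a x + \<beta>"
    unfolding f mult.assoc by simp
  then show "a x = 2 * cm_hat A \<mu> m0 * (f x * m0 x - \<beta>)"
    using nz by simp
qed

lemma form_ii_continuous:
  assumes "form_ii A \<mu> f k m0 a \<beta>" "continuous_in T m0"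
  shows "continuous_in T k" "continuous_in T f \<longleftrightarrow> continuous_in T a"
proof -
  have "k = (\<lambda>x. (2 * cm_hat A \<mu> m0) * m0 x)"
    and f: "f = (\<lambda>x. (1 / (2 * cm_hat A \<mu> m0) * a x + \<beta>) * m0 x)"
    using assms(1) by (auto simp: form_ii_def)
  then show "continuous_in T k" using continuous_in_mult[of T "\<lambda>_. 2 * cm_hat A \<mu> m0" m0] assms(2) by simp
  have "continuous_on UNIV (\<lambda>p::complex \<times> complex. 2 * cm_hat A \<mu> m0 * (fst p * snd p - \<beta>))"
    "continuous_on UNIV (\<lambda>p::complex \<times> complex. (1 / (2 * cm_hat A \<mu> m0) * fst p + \<beta>) * snd p)"
    by (intro continuous_intros)+
  note F = continuous_map_combine[OF _ assms(2) this(1), of f]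
    and A = continuous_map_combine[OF _ assms(2) this(2), of a]
  show "continuous_in T f \<longleftrightarrow> continuous_in T a"
  proof
    assume "continuous_in T f"
    from F[OF this] show "continuous_in T a"
      by (subst form_ii_additive_eq[OF assms(1)]) simp
  next
    assume "continuous_in T a"
    from A[OF this] show "continuous_in T f" by (subst f) simp
  qed
qed

lemma form_i_topological:
  assumes "topological_group T" "form_i A \<mu> f k m \<gamma> \<delta>" "f \<noteq> (\<lambda>_. 0)" "k \<noteq> (\<lambda>_. 0)"
    and "continuous_in T f \<or> continuous_in T k"
  shows "continuous_in T m"
proof -
  have "continuous_in T m \<or> continuous_in T (check m)"
    by (rule form_i_component[OF continuous_in_translates[OF assms(1)] assms(2-5)])
  moreover have "check (check m) = m" by (simp add: check_def)
  ultimately show ?thesis using continuous_in_check[OF assms(1), of "check m"] by auto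
qed

lemma form_i_haar_measurable:
  assumes "topological_group T" "Hausdorff_space T" "haar_measure T H"
    and "form_i A \<mu> f k m \<gamma> \<delta>" "f \<noteq> (\<lambda>_. 0)" "k \<noteq> (\<lambda>_. 0)"
    and "haar_measurable H f \<or> haar_measurable H k"
  shows "continuous_in T m"
proof -
  have m: "exponential m" using assms(4) by (simp add: form_i_def)
  have "haar_measurable H m \<or> haar_measurable H (check m)"
    by (rule form_i_component[OF haar_measurable_translates[OF assms(1,3)] assms(4-7)])
  then have "continuous_in T m \<or> continuous_in T (check m)"
    using haar_measurable_exponential_continuous[OF assms(1-3)] m exponential_check[OF m] by blast
  moreover have "check (check m) = m" by (simp add: check_def)
  ultimately show ?thesis using continuous_in_check[OF assms(1), of "check m"] by auto
qed

lemma form_ii_haar_measurable: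
  assumes "topological_group T" "Hausdorff_space T" "haar_measure T H"
    and "form_ii A \<mu> f k m0 a \<beta>" "f \<noteq> (\<lambda>_. 0)" "k \<noteq> (\<lambda>_. 0)"
    and "haar_measurable H f \<or> haar_measurable H k"
  shows "continuous_in T m0" "haar_measurable H f \<Longrightarrow> continuous_in T a"
proof -
  have m: "exponential m0" and a: "Modules.additive a" using assms(4) by (auto simp: form_ii_def)
  have meas: "haar_measurable H m0"
    by (rule form_ii_component[OF haar_measurable_translates[OF assms(1,3)] assms(4-7)])
  then show "continuous_in T m0"
    by (rule haar_measurable_exponential_continuous[OF assms(1-3) _ m])
  assume "haar_measurable H f"
  then have "haar_measurable H (\<lambda>x. 2 * cm_hat A \<mu> m0 * (f x * m0 x - \<beta>))"
    using meas unfolding haar_measurable_def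
    by (intro borel_measurable_times borel_measurable_diff borel_measurable_const)
  then have "haar_measurable H a" using form_ii_additive_eq[OF assms(4)] by simp
  then show "continuous_in T a"
    by (rule haar_measurable_additive_continuous[OF assms(1-3) _ a])
qed

lemma form_i_ess_bounded:
  assumes "topological_group T" "Hausdorff_space T" "haar_measure T H"
    and "form_i A \<mu> f k m \<gamma> \<delta>" "f \<noteq> (\<lambda>_. 0)" "k \<noteq> (\<lambda>_. 0)"
    and "(ess_bounded H f \<and> haar_measurable H f) \<or> (ess_bounded H k \<and> haar_measurable H k)"
  shows "character T m"
proof -
  have m: "exponential m" using assms(4) by (simp add: form_i_def)
  have cont: "continuous_in T m"
    using form_i_haar_measurable[OF assms(1-6)] assms(7) by blast
  have b: "bounded (range f) \<or> bounded (range k)"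
    using assms(7) ess_bounded_continuous_imp_bounded[OF assms(1-3)]
      form_i_continuous[OF assms(1,4) cont] by blast
  have "bounded (range m) \<or> bounded (range (check m))"
    by (rule form_i_component[where P = "\<lambda>h. bounded (range h)", OF _ assms(4-6) b])
      (rule bounded_translates)
  moreover have "range (check m) = range m"
    unfolding check_def using surj_uminus by (metis (no_types) image_image)
  ultimately have "bounded (range m)" by simp
  then show ?thesis
    using cont bounded_exponential_norm_1[OF m] exponential_add[OF m] by (simp add: character_def)
qed

lemma form_ii_ess_bounded:
  assumes "topological_group T" "Hausdorff_space T" "haar_measure T H"
    and "form_ii A \<mu> f k m0 a \<beta>" "f \<noteq> (\<lambda>_. 0)" "k \<noteq> (\<lambda>_. 0)"
    and "(ess_bounded H f \<and> haar_measurable H f) \<or> (ess_bounded H k \<and> haar_measurable H k)"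
  shows "character T m0" "ess_bounded H f \<Longrightarrow> haar_measurable H f \<Longrightarrow> a = (\<lambda>_. 0)"
proof -
  have m: "exponential m0" and a: "Modules.additive a" using assms(4) by (auto simp: form_ii_def)
  have "haar_measurable H f \<or> haar_measurable H k" using assms(7) by blast
  note meas = form_ii_haar_measurable[OF assms(1-6) this]
  note cont = form_ii_continuous[OF assms(4) meas(1)]
  have b: "bounded (range f) \<or> bounded (range k)"
    using assms(7) ess_bounded_continuous_imp_bounded[OF assms(1-3)] cont meas by blast
  have "bounded (range m0)"
    by (rule form_ii_component[where P = "\<lambda>h. bounded (range h)", OF _ assms(4-6) b])
      (rule bounded_translates)
  note norm_1 = bounded_exponential_norm_1[OF m this]
  then show "character T m0"
    using meas(1) exponential_add[OF m] by (simp add: character_def)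
  assume f: "ess_bounded H f" "haar_measurable H f"
  then have "bounded (range f)"
    using ess_bounded_continuous_imp_bounded[OF assms(1-3)] cont meas by blast
  then obtain C where C: "\<And>x. norm (f x) \<le> C" by (auto simp: bounded_iff)
  have "norm (a x) \<le> norm (2 * cm_hat A \<mu> m0) * (C + norm \<beta>)" for x
  proof -
    have "norm (f x * m0 x - \<beta>) \<le> norm (f x * m0 x) + norm \<beta>" by (rule norm_triangle_ineq4)
    also have "\<dots> \<le> C + norm \<beta>" using C[of x] by (simp add: norm_mult norm_1)
    finally show ?thesis
      by (subst form_ii_additive_eq[OF assms(4)], subst norm_mult) (rule mult_left_mono, simp_all)
  qed
  then have "bounded (range a)" by (auto simp: bounded_iff)
  then show "a = (\<lambda>_. 0)" using bounded_additive_zero[OF a] by blast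
qed

theorem theorem5:
  fixes A :: "'a::ab_group_add set set" and \<mu> :: "'a set \<Rightarrow> complex"
  assumes "complex_measure A \<mu>"
  shows
    "(\<forall>f k. f \<noteq> (\<lambda>_. 0) \<longrightarrow> k \<noteq> (\<lambda>_. 0) \<longrightarrow> solves A \<mu> f k \<longrightarrow>
        ((\<exists>m \<gamma> \<delta>. form_i A \<mu> f k m \<gamma> \<delta>) \<or> (\<exists>m0 a \<beta>. form_ii A \<mu> f k m0 a \<beta>)) \<and>
        (\<forall>T. topological_group T \<longrightarrow> continuous_in T f \<or> continuous_in T k \<longrightarrow>
           (\<forall>m \<gamma> \<delta>. form_i A \<mu> f k m \<gamma> \<delta> \<longrightarrow> continuous_in T m) \<and>
           (\<forall>m0 a \<beta>. form_ii A \<mu> f k m0 a \<beta> \<longrightarrow>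
              continuous_in T m0 \<and> (continuous_in T f \<longrightarrow> continuous_in T a))) \<and>
        (\<forall>T H. lca_group T \<longrightarrow> haar_measure T H \<longrightarrow>
           haar_measurable H f \<or> haar_measurable H k \<longrightarrow>
           (\<forall>m \<gamma> \<delta>. form_i A \<mu> f k m \<gamma> \<delta> \<longrightarrow>
              continuous_in T f \<and> continuous_in T k \<and> continuous_in T m) \<and>
           (\<forall>m0 a \<beta>. form_ii A \<mu> f k m0 a \<beta> \<longrightarrow>
              continuous_in T k \<and> continuous_in T m0 \<and>
              (haar_measurable H f \<longrightarrow> continuous_in T f \<and> continuous_in T a))) \<and>
        (\<forall>T H. lca_group T \<longrightarrow> haar_measure T H \<longrightarrow>
           (ess_bounded H f \<and> haar_measurable H f) \<or> (ess_bounded H k \<and> haar_measurable H k) \<longrightarrow>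
           (\<forall>m \<gamma> \<delta>. form_i A \<mu> f k m \<gamma> \<delta> \<longrightarrow>
              continuous_in T f \<and> continuous_in T k \<and> character T m) \<and>
           (\<forall>m0 a \<beta>. form_ii A \<mu> f k m0 a \<beta> \<longrightarrow>
              continuous_in T k \<and> character T m0 \<and>
              (ess_bounded H f \<and> haar_measurable H f \<longrightarrow>
                 continuous_in T f \<and> a = (\<lambda>_. 0))))) \<and>
     (\<forall>f k m \<gamma> \<delta>. form_i A \<mu> f k m \<gamma> \<delta> \<longrightarrow> solves A \<mu> f k) \<and>
     (\<forall>f k m0 a \<beta>. form_ii A \<mu> f k m0 a \<beta> \<longrightarrow> solves A \<mu> f k)"
proof (intro conjI allI impI)
  fix f k :: "'a \<Rightarrow> complex"
  {
    fix m \<gamma> \<delta> assume "form_i A \<mu> f k m \<gamma> \<delta>"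
    then show "solves A \<mu> f k" by (rule form_i_solves)
  next
    fix m0 a \<beta> assume "form_ii A \<mu> f k m0 a \<beta>"
    then show "solves A \<mu> f k" by (rule form_ii_solves)
  }
  assume nz: "f \<noteq> (\<lambda>_. 0)" "k \<noteq> (\<lambda>_. 0)"
  {
    assume "solves A \<mu> f k"
    with nz show "(\<exists>m \<gamma> \<delta>. form_i A \<mu> f k m \<gamma> \<delta>) \<or> (\<exists>m0 a \<beta>. form_ii A \<mu> f k m0 a \<beta>)"
      by (rule solves_imp_form)
  }
  {
    fix T assume T: "topological_group T" and fk: "continuous_in T f \<or> continuous_in T k"
    {
      fix m \<gamma> \<delta> assume "form_i A \<mu> f k m \<gamma> \<delta>"
      from form_i_topological[OF T this nz fk] show "continuous_in T m" .
    next
      fix m0 a \<beta> assume form: "form_ii A \<mu> f k m0 a \<beta>"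
      show m0: "continuous_in T m0"
        by (rule form_ii_component[OF continuous_in_translates[OF T] form nz fk])
      show "continuous_in T a" if "continuous_in T f"
        using form_ii_continuous(2)[OF form m0] that by blast
    }
  }
  {
    fix T H assume "lca_group T" and H: "haar_measure T H"
      and fk: "haar_measurable H f \<or> haar_measurable H k"
    then have T: "topological_group T" "Hausdorff_space T" by (auto simp: lca_group_def)
    {
      fix m \<gamma> \<delta> assume form: "form_i A \<mu> f k m \<gamma> \<delta>"
      show m: "continuous_in T m" by (rule form_i_haar_measurable[OF T H form nz fk])
      show "continuous_in T f" "continuous_in T k" by (rule form_i_continuous[OF T(1) form m])+
    next
      fix m0 a \<beta> assume form: "form_ii A \<mu> f k m0 a \<beta>"
      note cont = form_ii_haar_measurable[OF T H form nz fk]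
      show "continuous_in T m0" by (rule cont(1))
      show "continuous_in T k" by (rule form_ii_continuous(1)[OF form cont(1)])
      assume "haar_measurable H f"
      from cont(2)[OF this] show "continuous_in T a" .
      then show "continuous_in T f" using form_ii_continuous(2)[OF form cont(1)] by blast
    }
  }
  {
    fix T H assume "lca_group T" and H: "haar_measure T H"
      and fk: "(ess_bounded H f \<and> haar_measurable H f) \<or> (ess_bounded H k \<and> haar_measurable H k)"
    then have T: "topological_group T" "Hausdorff_space T"
      and meas: "haar_measurable H f \<or> haar_measurable H k" by (auto simp: lca_group_def)
    {
      fix m \<gamma> \<delta> assume form: "form_i A \<mu> f k m \<gamma> \<delta>"
      have "continuous_in T m" by (rule form_i_haar_measurable[OF T H form nz meas])
      then show "continuous_in T f" "continuous_in T k" by (rule form_i_continuous[OF T(1) form])+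
      show "character T m" by (rule form_i_ess_bounded[OF T H form nz fk])
    next
      fix m0 a \<beta> assume form: "form_ii A \<mu> f k m0 a \<beta>"
      note cont = form_ii_haar_measurable[OF T H form nz meas]
      show "continuous_in T k" by (rule form_ii_continuous(1)[OF form cont(1)])
      show "character T m0" by (rule form_ii_ess_bounded[OF T H form nz fk])
      assume f: "ess_bounded H f \<and> haar_measurable H f"
      then show "continuous_in T f" using cont(2) form_ii_continuous(2)[OF form cont(1)] by blast
      show "a = (\<lambda>_. 0)" using form_ii_ess_bounded(2)[OF T H form nz fk] f by blast
    }
  }
qed

end
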